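(* Suppose that for every odd $n \ge 1$, every $m \geq 1$ and every $\sigma \in Q_2(m,n)$, \[ \sum_{\tau \in Q_2(m,n),\ \pi(\tau)=\pi(\sigma)} (-1)^{|\tau|} = 0 . \] Then for every odd $n \ge 1$ and every $m \geq 1$, \[ Z(C_{m,n}) = \begin{cases} -2 & \text{if } 3 \mid \gcd(m-1,n),\\ 1 & \text{otherwise.}\end{cases} \]
   Context: For integers $m,n\ge 1$, $C_{m,n}$ is the graph with vertex set $\{1,\dots,m\}\times\{1,\dots,n\}$ in which $(i,j)$ and $(i',j')$ are adjacent iff either $i=i'$ and $j-j' \equiv \pm 1 \pmod n$, or $j=j'$ and $|i-i'|=1$ (when $n=1$ every vertex is adjacent to itself, so $\emptyset$ is the only independent set). $I(C_{m,n})$ is the complex of all independent sets of $C_{m,n}$, including $\emptyset$, and $Z(C_{m,n}) = \sum_{\sigma\in I(C_{m,n})} (-1)^{|\sigma|}$. For $\sigma \in I(C_{m,n})$ let $\pi(\sigma)=\{(1,j)\in\sigma\} = \{x_1,\dots,x_k\}$, $x_i=(1,j_i)$, $j_1<\dots<j_k$. If $k\ge1$, the intervals of $\sigma$ are $N_i = \{(1,j_{i-1}+1),(1,j_{i-1}+2),\dots,(1,j_i)\}$ for $1\le i\le k$, second coordinates taken modulo $n$ and $j_0=j_k$ (if $k=1$, $N_1$ is the whole first row, listed starting just after $x_1$ and ending at $x_1$). The $\ell$-th element of $N_i$ in this listing is in an even (odd) position if $\ell$ is even (odd). A vertex $x$ is free in $\sigma$ if $x\notin\sigma$ and $\sigma\cup\{x\}$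 is independent. $Q_2(m,n)$ is the set of $\sigma\in I(C_{m,n})$ with $\pi(\sigma)\neq\emptyset$ such that all intervals of $\sigma$ have odd length, at least one has length greater than $3$, and no vertex in an even position of an interval is free in $\sigma$. *)

theory Defs
  imports Main "HOL-Number_Theory.Cong"
begin

type_synonym vertex = "nat \<times> nat"

definition vertices :: "nat \<Rightarrow> nat \<Rightarrow> vertex set" where
  "vertices m n = {1..m} \<times> {1..n}"

text \<open>Since the congruence modulo 1 always holds, every vertex is adjacent to itself for n = 1.
  The congruences are taken in the integers to avoid truncated subtraction.\<close>

definition adjacent :: "nat \<Rightarrow> vertex \<Rightarrow> vertex \<Rightarrow> bool" where
  "adjacent n x y \<longleftrightarrow>
     (fst x = fst y \<and>
       ([int (snd x) - int (snd y) = 1] (mod int n) \<or>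
        [int (snd x) - int (snd y) = -1] (mod int n))) \<or>
     (snd x = snd y \<and> \<bar>int (fst x) - int (fst y)\<bar> = 1)"

text \<open>The two vertices x and y below may coincide; this matters exactly when there are loops.\<close>

definition independent_sets :: "nat \<Rightarrow> nat \<Rightarrow> vertex set set" where
  "independent_sets m n =
     {\<sigma>. \<sigma> \<subseteq> vertices m n \<and> (\<forall>x\<in>\<sigma>. \<forall>y\<in>\<sigma>. \<not> adjacent n x y)}"

definition Z :: "nat \<Rightarrow> nat \<Rightarrow> int" where
  "Z m n = (\<Sum>\<sigma>\<in>independent_sets m n. (-1) ^ card \<sigma>)"

definition first_row :: "vertex set \<Rightarrow> vertex set" where
  "first_row \<sigma> = {x \<in> \<sigma>. fst x = 1}"

definition first_row_cols :: "vertex set \<Rightarrow> nat list" where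
  "first_row_cols \<sigma> = sorted_list_of_set (snd ` first_row \<sigma>)"

text \<open>Let \<open>j\<^sub>1 < \<dots> < j\<^sub>k\<close> be the columns of \<open>\<sigma>\<close> in the first row.
  The interval \<open>N\<^sub>1\<close> starts just after \<open>j\<^sub>0 = j\<^sub>k\<close>, wraps around modulo n and
  ends at \<open>j\<^sub>1\<close>; written out, its columns are \<open>j\<^sub>k + 1, \<dots>, n, 1, \<dots>, j\<^sub>1\<close>.
  If \<open>k = 1\<close>, this is the whole first row. The later intervals do not wrap around.
  The index i runs over \<open>1, \<dots>, k\<close>, whereas list indexing with \<open>!\<close> starts at 0.\<close>

definition interval :: "nat \<Rightarrow> vertex set \<Rightarrow> nat \<Rightarrow> vertex list" where
  "interval n \<sigma> i =
     (let js = first_row_cols \<sigma> in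
      map (Pair 1)
        (if i = 1 then [last js + 1..<n + 1] @ [1..<hd js + 1]
         else [js ! (i - 2) + 1..<js ! (i - 1) + 1]))"

definition intervals :: "nat \<Rightarrow> vertex set \<Rightarrow> vertex list set" where
  "intervals n \<sigma> = interval n \<sigma> ` {1..card (first_row \<sigma>)}"

definition free_in :: "nat \<Rightarrow> nat \<Rightarrow> vertex set \<Rightarrow> vertex \<Rightarrow> bool" where
  "free_in m n \<sigma> x \<longleftrightarrow> x \<notin> \<sigma> \<and> insert x \<sigma> \<in> independent_sets m n"

definition Q2 :: "nat \<Rightarrow> nat \<Rightarrow> vertex set set" where
  "Q2 m n = {\<sigma> \<in> independent_sets m n.
     first_row \<sigma> \<noteq> {} \<and>
     (\<forall>N\<in>intervals n \<sigma>. odd (length N)) \<and>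
     (\<exists>N\<in>intervals n \<sigma>. length N > 3) \<and>
     (\<forall>N\<in>intervals n \<sigma>. \<forall>l\<in>{1..length N}. even l \<longrightarrow> \<not> free_in m n \<sigma> (N ! (l - 1)))}"

text \<open>All sums over these sets are therefore genuine finite sums.\<close>

lemma finite_independent_sets: "finite (independent_sets m n)"
  by (rule finite_subset[of _ "Pow (vertices m n)"])
     (auto simp: independent_sets_def vertices_def)

end

theory Submission
  imports Defs
begin

text \<open>
  For \<open>n = 1\<close> only the empty set is independent. For odd \<open>n \<ge> 3\<close> the sum \<open>Z m n\<close> is computed by
  removing the first row. Call the cyclic distance from a column
  back to the previous occupied column of the first row its gap; in an interval, the gap of an
  entry is exactly its position. Call a column active if its gap is even and the first-row
  vertex in it has no neighbour in \<open>\<sigma>\<close>, that is, if this vertex is either an element of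
  \<open>\<sigma>\<close> closing an interval of even length, or free in an even position.

  Toggling an active vertex changes no gap parity (\<open>toggle_even_gap\<close>), and two cyclically
  consecutive columns never both have even gaps; so it changes neither the set of active columns
  nor the fact that the first row is occupied, for which \<open>n\<close> has to be odd. Toggling the
  smallest active column is then a sign-reversing involution, and the sets with an active column
  cancel (\<open>sum_with_active_eq_0\<close>).

  A set with occupied first row but no active column has only odd intervals. If one of them is
  longer than 3, it lies in \<open>Q2 m n\<close>, and these sets contribute 0 by hypothesis. Otherwise all
  intervals have length 3, so that 3 divides \<open>n\<close> and the first row is one of the three residue
  classes modulo 3 (\<open>no_active_cases\<close>). Sets with empty first row contribute
  \<open>Z (m - 1) n\<close>. Hence \<open>Z m n = Z (m - 1) n\<close> if 3 does not divide \<open>n\<close>, and otherwise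
  \<open>Z m n = Z (m - 1) n - 3 y\<close>, where \<open>y\<close> is the signed sum for the lower \<open>m - 1\<close> rows with
  one residue class deleted from the uppermost of them; the sign is that of the odd number
  \<open>n / 3\<close> of vertices in the residue class.

  The number \<open>y\<close> follows from two local reductions: a vertex whose neighbourhood contains that
  of a vertex not adjacent to it may be deleted (\<open>indep_sum_fold\<close>), and an isolated edge
  contributes a factor -1 (\<open>indep_sum_isolated_edges\<close>). They strip three rows at a time and
  show that \<open>y\<close> is 1, -1 or 0 according to the number of rows modulo 3
  (\<open>indep_sum_grid_top_not3_closed\<close>), from which the recursion gives the claimed values.
\<close>

section \<open>Signed sums over independent sets\<close>

definition indep :: "('a \<Rightarrow> 'a \<Rightarrow> bool) \<Rightarrow> 'a set \<Rightarrow> 'a set set" where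
  "indep E A = {\<sigma>. \<sigma> \<subseteq> A \<and> (\<forall>x\<in>\<sigma>. \<forall>y\<in>\<sigma>. \<not> E x y)}"

definition indep_sum :: "('a \<Rightarrow> 'a \<Rightarrow> bool) \<Rightarrow> 'a set \<Rightarrow> int" where
  "indep_sum E A = (\<Sum>\<sigma>\<in>indep E A. (-1) ^ card \<sigma>)"

definition toggle :: "'a \<Rightarrow> 'a set \<Rightarrow> 'a set" where
  "toggle x \<sigma> = (if x \<in> \<sigma> then \<sigma> - {x} else insert x \<sigma>)"

lemma finite_indep: "finite A \<Longrightarrow> finite (indep E A)"
  by (rule finite_subset[of _ "Pow A"]) (auto simp: indep_def)

lemma indep_sum_empty [simp]: "indep_sum E {} = 1"
proof -
  have "indep E {} = {{}}" by (auto simp: indep_def)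
  then show ?thesis by (simp add: indep_sum_def)
qed

lemma toggle_toggle [simp]: "toggle x (toggle x \<sigma>) = \<sigma>"
  by (auto simp: toggle_def)

lemma sign_toggle:
  assumes "finite \<sigma>"
  shows "(-1) ^ card (toggle x \<sigma>) = - ((-1) ^ card \<sigma> :: int)"
proof (cases "x \<in> \<sigma>")
  case True
  then have "(-1) ^ card \<sigma> = - ((-1) ^ card (\<sigma> - {x}) :: int)"
    using card.remove[OF assms True] by (simp only: power_Suc)
  then show ?thesis using True by (simp only: toggle_def if_True minus_minus)
qed (simp add: toggle_def assms)

text \<open>A sign-reversing involution without fixed points: the vertex to be toggled may depend on
  the set, as long as toggling does not change the choice.\<close>

lemma sum_toggle_eq_0:
  assumes fin: "\<And>\<sigma>. \<sigma> \<in> S \<Longrightarrow> finite \<sigma>"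
    and step: "\<And>\<sigma>. \<sigma> \<in> S \<Longrightarrow> toggle (f \<sigma>) \<sigma> \<in> S"
    and inv: "\<And>\<sigma>. \<sigma> \<in> S \<Longrightarrow> f (toggle (f \<sigma>) \<sigma>) = f \<sigma>"
  shows "(\<Sum>\<sigma>\<in>S. (-1) ^ card \<sigma>) = (0 :: int)"
proof -
  have "(\<Sum>\<sigma>\<in>S. (-1) ^ card \<sigma>) = (\<Sum>\<sigma>\<in>S. - ((-1) ^ card \<sigma>) :: int)"
  proof (rule sum.reindex_bij_witness[where i = "\<lambda>\<sigma>. toggle (f \<sigma>) \<sigma>"
        and j = "\<lambda>\<sigma>. toggle (f \<sigma>) \<sigma>"])
    fix \<sigma> assume \<sigma>: "\<sigma> \<in> S"
    show "toggle (f (toggle (f \<sigma>) \<sigma>)) (toggle (f \<sigma>) \<sigma>) = \<sigma>"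
      unfolding inv[OF \<sigma>] by (rule toggle_toggle)
    then show "toggle (f (toggle (f \<sigma>) \<sigma>)) (toggle (f \<sigma>) \<sigma>) = \<sigma>" .
    show "toggle (f \<sigma>) \<sigma> \<in> S" by (rule step[OF \<sigma>])
    then show "toggle (f \<sigma>) \<sigma> \<in> S" .
    show "- ((-1) ^ card (toggle (f \<sigma>) \<sigma>)) = ((-1) ^ card \<sigma> :: int)"
      unfolding sign_toggle[OF fin[OF \<sigma>]] by simp
  qed
  also have "\<dots> = - (\<Sum>\<sigma>\<in>S. (-1) ^ card \<sigma>)"
    by (rule sum_negf)
  finally show ?thesis by linarith
qed

text \<open>If \<open>u\<close> and \<open>v\<close> are not adjacent and \<open>N(u) \<subseteq> N(v)\<close>, then in an independent set containing
  \<open>v\<close> the vertex \<open>u\<close> can be toggled freely, so the sets containing \<open>v\<close> cancel and \<open>v\<close> can be deleted. A whole set \<open>V\<close> of such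
  vertices can be deleted at once if the witnesses \<open>u\<close> lie outside \<open>V\<close>, since toggling them
  then leaves the trace of the independent set on \<open>V\<close> unchanged.\<close>

lemma indep_sum_fold:
  assumes finA: "finite A" and sym: "symp E"
    and dom: "\<And>v. v \<in> V \<Longrightarrow>
      \<exists>u\<in>A - V. \<not> E u u \<and> \<not> E u v \<and> (\<forall>w\<in>A. E u w \<longrightarrow> E v w)"
  shows "indep_sum E A = indep_sum E (A - V)"
proof -
  obtain u where u: "\<And>v. v \<in> V \<Longrightarrow> u v \<in> A - V \<and> \<not> E (u v) (u v) \<and> \<not> E (u v) v \<and>
      (\<forall>w\<in>A. E (u v) w \<longrightarrow> E v w)"
    using dom by metis
  define S where "S = {\<sigma>\<in>indep E A. \<sigma> \<inter> V \<noteq> {}}"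
  \<comment> \<open>The choice depends on the trace on \<open>V\<close> only, hence survives the toggling.\<close>
  define p where "p \<sigma> = (SOME v. v \<in> \<sigma> \<inter> V)" for \<sigma>
  have p: "p \<sigma> \<in> \<sigma> \<inter> V" if "\<sigma> \<in> S" for \<sigma>
    unfolding p_def using that someI_ex[of "\<lambda>v. v \<in> \<sigma> \<inter> V"] by (auto simp: S_def)
  have tog: "toggle (u (p \<sigma>)) \<sigma> \<inter> V = \<sigma> \<inter> V" if "\<sigma> \<in> S" for \<sigma>
    using u p[OF that] by (auto simp: toggle_def)
  have "(\<Sum>\<sigma>\<in>S. (-1) ^ card \<sigma>) = (0 :: int)"
  proof (rule sum_toggle_eq_0[where f = "\<lambda>\<sigma>. u (p \<sigma>)"])
    show "finite \<sigma>" if "\<sigma> \<in> S" for \<sigma>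
      using that finite_subset[OF _ finA] by (auto simp: S_def indep_def)
    show "u (p (toggle (u (p \<sigma>)) \<sigma>)) = u (p \<sigma>)" if "\<sigma> \<in> S" for \<sigma>
      using tog[OF that] by (simp add: p_def)
    show "toggle (u (p \<sigma>)) \<sigma> \<in> S" if \<sigma>: "\<sigma> \<in> S" for \<sigma>
    proof -
      have no_edge: "\<not> E (u (p \<sigma>)) w" if "w \<in> \<sigma>" for w
        using \<sigma> that p[OF \<sigma>] u[of "p \<sigma>"] by (auto simp: S_def indep_def)
      then have "\<not> E w (u (p \<sigma>))" if "w \<in> \<sigma>" for w
        using that sympD[OF sym] by blast
      with no_edge have "toggle (u (p \<sigma>)) \<sigma> \<in> indep E A"
        using \<sigma> p[OF \<sigma>] u[of "p \<sigma>"] by (auto simp: S_def indep_def toggle_def)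
      then show ?thesis
        using tog[OF \<sigma>] \<sigma> by (simp add: S_def)
    qed
  qed
  moreover have "indep E A = indep E (A - V) \<union> S" "indep E (A - V) \<inter> S = {}"
    by (auto simp: indep_def S_def)
  then have "indep_sum E A = indep_sum E (A - V) + (\<Sum>\<sigma>\<in>S. (-1) ^ card \<sigma>)"
    unfolding indep_sum_def using finA by (metis sum.union_disjoint finite_Un finite_indep)
  ultimately show ?thesis by simp
qed

lemma indep_sum_isolated_vertex:
  assumes finA: "finite A" and sym: "symp E" and u: "u \<in> A" "\<And>w. w \<in> A \<Longrightarrow> \<not> E u w"
  shows "indep_sum E A = 0"
  unfolding indep_sum_def
proof (rule sum_toggle_eq_0[where f = "\<lambda>_. u"])
  show "finite \<sigma>" if "\<sigma> \<in> indep E A" for \<sigma>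
    using that finite_subset[OF _ finA] by (auto simp: indep_def)
  have "\<not> E w u" if "w \<in> A" for w
    using u(2)[OF that] sympD[OF sym] by blast
  then show "toggle u \<sigma> \<in> indep E A" if "\<sigma> \<in> indep E A" for \<sigma>
    using that u by (auto simp: indep_def toggle_def)
qed simp

lemma sum_indep_containing:
  assumes finA: "finite A" and sym: "symp E" and \<rho>: "\<rho> \<in> indep E A"
  shows "(\<Sum>\<sigma> | \<sigma> \<in> indep E A \<and> \<rho> \<subseteq> \<sigma>. (-1) ^ card \<sigma>) =
    (-1) ^ card \<rho> * indep_sum E {w \<in> A - \<rho>. \<forall>x\<in>\<rho>. \<not> E x w}"
proof -
  let ?B = "{w \<in> A - \<rho>. \<forall>x\<in>\<rho>. \<not> E x w}"
  have "(\<Sum>\<sigma> | \<sigma> \<in> indep E A \<and> \<rho> \<subseteq> \<sigma>. (-1) ^ card \<sigma>) =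
      (\<Sum>\<tau>\<in>indep E ?B. (-1) ^ card \<rho> * (-1) ^ card \<tau> :: int)"
  proof (rule sum.reindex_bij_witness[where i = "\<lambda>\<tau>. \<tau> \<union> \<rho>" and j = "\<lambda>\<sigma>. \<sigma> - \<rho>"])
    fix \<sigma> assume \<sigma>: "\<sigma> \<in> {\<sigma> \<in> indep E A. \<rho> \<subseteq> \<sigma>}"
    then show "\<sigma> - \<rho> \<union> \<rho> = \<sigma>" "\<sigma> - \<rho> \<in> indep E ?B" by (auto simp: indep_def)
    have "finite \<sigma>" using \<sigma> finite_subset[OF _ finA] by (auto simp: indep_def)
    then have "card \<sigma> = card \<rho> + card (\<sigma> - \<rho>)"
      using \<sigma> card_mono[of \<sigma> \<rho>] by (simp add: card_Diff_subset finite_subset[of \<rho> \<sigma>])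
    then show "(-1) ^ card \<rho> * (-1) ^ card (\<sigma> - \<rho>) = ((-1) ^ card \<sigma> :: int)"
      by (simp add: power_add)
  next
    fix \<tau> assume \<tau>: "\<tau> \<in> indep E ?B"
    then show "\<tau> \<union> \<rho> - \<rho> = \<tau>" by (auto simp: indep_def)
    have "\<not> E x y" "\<not> E y x" if "x \<in> \<tau>" "y \<in> \<rho>" for x y
      using \<tau> that sympD[OF sym] by (auto simp: indep_def)
    then show "\<tau> \<union> \<rho> \<in> {\<sigma> \<in> indep E A. \<rho> \<subseteq> \<sigma>}"
      using \<tau> \<rho> by (auto simp: indep_def)
  qed
  then show ?thesis by (simp add: indep_sum_def sum_distrib_left)
qed

text \<open>Without \<open>p\<close> the vertex \<open>q\<close> is isolated and everything cancels; with \<open>p\<close>, the vertex \<open>q\<close> is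
  excluded and the rest is arbitrary.\<close>

lemma indep_sum_isolated_edge:
  assumes finA: "finite B" and sym: "symp E" and pq: "p \<noteq> q" "p \<notin> B" "q \<notin> B"
    and E: "E p q" "\<not> E p p" "\<not> E q q" "\<And>w. w \<in> B \<Longrightarrow> \<not> E p w \<and> \<not> E q w"
  shows "indep_sum E (insert p (insert q B)) = - indep_sum E B"
proof -
  let ?A = "insert p (insert q B)"
  have "indep E ?A = indep E (insert q B) \<union> {\<sigma> \<in> indep E ?A. {p} \<subseteq> \<sigma>}"
    "indep E (insert q B) \<inter> {\<sigma> \<in> indep E ?A. {p} \<subseteq> \<sigma>} = {}"
    using pq by (auto simp: indep_def)
  then have "indep_sum E ?A = indep_sum E (insert q B) +
      (\<Sum>\<sigma> | \<sigma> \<in> indep E ?A \<and> {p} \<subseteq> \<sigma>. (-1) ^ card \<sigma>)"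
    unfolding indep_sum_def using finA
    by (metis (no_types, lifting) sum.union_disjoint finite_Un finite_indep finite_insert)
  moreover have "indep_sum E (insert q B) = 0"
    using finA E by (intro indep_sum_isolated_vertex[OF _ sym, of _ q]) auto
  moreover have "{w \<in> ?A - {p}. \<forall>x\<in>{p}. \<not> E x w} = B"
    using pq E by auto
  moreover have "{p} \<in> indep E ?A" using E by (auto simp: indep_def)
  ultimately show ?thesis
    using sum_indep_containing[of ?A E "{p}"] finA sym by simp
qed

lemma indep_sum_isolated_edges:
  assumes "finite K" and finA: "finite B" and sym: "symp E"
    and inj: "inj_on p K" "inj_on q K" "p ` K \<inter> q ` K = {}" "p ` K \<inter> B = {}" "q ` K \<inter> B = {}"
    and E: "\<And>k. k \<in> K \<Longrightarrow> E (p k) (q k)"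
      "\<And>k w. k \<in> K \<Longrightarrow> w \<in> p ` K \<union> q ` K \<union> B \<Longrightarrow> E (p k) w \<Longrightarrow> w = q k"
      "\<And>k w. k \<in> K \<Longrightarrow> w \<in> p ` K \<union> q ` K \<union> B \<Longrightarrow> E (q k) w \<Longrightarrow> w = p k"
  shows "indep_sum E (p ` K \<union> q ` K \<union> B) = (-1) ^ card K * indep_sum E B"
  using assms(1) inj E
proof (induction K rule: finite_induct)
  case empty
  show ?case by simp
next
  case (insert k K)
  let ?B = "p ` K \<union> q ` K \<union> B"
  have inj: "inj_on p K" "inj_on q K" "p k \<notin> p ` K" "q k \<notin> q ` K"
    using insert.hyps(2) insert.prems(1,2) by simp_all
  have disj: "p ` K \<inter> q ` K = {}" "p ` K \<inter> B = {}" "q ` K \<inter> B = {}"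
    using insert.prems(3-5) by blast+
  have "p k \<noteq> q k" using insert.prems(3) by blast
  moreover have "p k \<notin> ?B" using inj(3) insert.prems(3,4) by blast
  moreover have "q k \<notin> ?B" using inj(4) insert.prems(3,5) by blast
  moreover have "\<not> E (p k) (p k)"
    using insert.prems(7)[of k "p k"] \<open>p k \<noteq> q k\<close> by blast
  moreover have "\<not> E (q k) (q k)"
    using insert.prems(8)[of k "q k"] \<open>p k \<noteq> q k\<close> by (metis UnI1 UnI2 imageI insertI1)
  moreover have "\<not> E (p k) w \<and> \<not> E (q k) w" if "w \<in> ?B" for w
    using insert.prems(7)[of k w] insert.prems(8)[of k w] that calculation by blast
  moreover have "E (p k) (q k)" using insert.prems(6) by simp
  ultimately have peel: "indep_sum E (insert (p k) (insert (q k) ?B)) = - indep_sum E ?B"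
    using finA insert.hyps(1) by (intro indep_sum_isolated_edge sym) auto
  have IH: "indep_sum E ?B = (-1) ^ card K * indep_sum E B"
  proof (rule insert.IH)
    show "inj_on p K" "inj_on q K" "p ` K \<inter> q ` K = {}" "p ` K \<inter> B = {}" "q ` K \<inter> B = {}"
      by (fact inj disj)+
    show "E (p k) (q k)" if "k \<in> K" for k using insert.prems(6) that by simp
    show "w = q k" if "k \<in> K" "w \<in> p ` K \<union> q ` K \<union> B" "E (p k) w" for k w
      using insert.prems(7)[of k w] that by blast
    show "w = p k" if "k \<in> K" "w \<in> p ` K \<union> q ` K \<union> B" "E (q k) w" for k w
      using insert.prems(8)[of k w] that by blast
  qed
  have "p ` insert k K \<union> q ` insert k K \<union> B = insert (p k) (insert (q k) ?B)" by auto
  then show ?case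
    using insert.hyps by (simp only: peel IH card_insert_disjoint power_Suc) simp
qed

lemma indep_sum_image:
  assumes inj: "inj_on f A" and E: "\<And>x y. x \<in> A \<Longrightarrow> y \<in> A \<Longrightarrow> E (f x) (f y) \<longleftrightarrow> E x y"
  shows "indep_sum E (f ` A) = indep_sum E A"
proof -
  have "bij_betw (image f) (indep E A) (indep E (f ` A))"
    unfolding bij_betw_def
  proof
    show "inj_on (image f) (indep E A)"
      using inj by (auto simp: inj_on_def indep_def inj_on_image_eq_iff[OF inj])
    show "image f ` indep E A = indep E (f ` A)"
    proof
      show "image f ` indep E A \<subseteq> indep E (f ` A)"
        using E by (auto simp: indep_def subset_iff)
      show "indep E (f ` A) \<subseteq> image f ` indep E A"
      proof
        fix \<tau> assume \<tau>: "\<tau> \<in> indep E (f ` A)"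
        then obtain \<sigma> where \<sigma>: "\<sigma> \<subseteq> A" "\<tau> = f ` \<sigma>"
          by (auto simp: indep_def subset_image_iff)
        then have "\<sigma> \<in> indep E A"
          using \<tau> E by (auto simp: indep_def subset_iff)
        then show "\<tau> \<in> image f ` indep E A" using \<sigma> by blast
      qed
    qed
  qed
  then have "indep_sum E (f ` A) = (\<Sum>\<sigma>\<in>indep E A. (-1) ^ card (f ` \<sigma>))"
    unfolding indep_sum_def by (rule sum.reindex_bij_betw[symmetric])
  also have "\<dots> = indep_sum E A"
    unfolding indep_sum_def
  proof (rule sum.cong)
    fix \<sigma> assume "\<sigma> \<in> indep E A"
    then have "inj_on f \<sigma>" using inj by (auto simp: indep_def intro: inj_on_subset)
    then show "(-1) ^ card (f ` \<sigma>) = ((-1) ^ card \<sigma> :: int)" by (simp add: card_image)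
  qed simp
  finally show ?thesis .
qed

section \<open>Adjacency in the cylinder\<close>

definition next_col :: "nat \<Rightarrow> nat \<Rightarrow> nat" where
  "next_col n j = (if j = n then 1 else j + 1)"

text \<open>For \<open>n \<ge> 3\<close> the congruences in the definition of adjacency amount to the cyclic successor
  on the columns.\<close>

lemma cong_1_iff_next_col:
  assumes "n \<ge> 3" "j \<in> {1..n}" "k \<in> {1..n}"
  shows "[int j - int k = 1] (mod int n) \<longleftrightarrow> j = next_col n k"
proof
  assume "[int j - int k = 1] (mod int n)"
  then obtain q where q: "int j - int k - 1 = int n * q"
    by (auto simp: cong_iff_dvd_diff)
  have "int n * (-2) < int n * q" "int n * q < int n * 1"
    using assms by (auto simp flip: q)
  then have "q = 0 \<or> q = -1"
    using assms by (simp only: mult_less_cancel_left_pos) auto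
  then show "j = next_col n k" using q assms by (auto simp: next_col_def)
next
  assume "j = next_col n k"
  then have "int j - int k - 1 = 0 \<or> int j - int k - 1 = - int n"
    using assms by (auto simp: next_col_def)
  then show "[int j - int k = 1] (mod int n)"
    by (auto simp: cong_iff_dvd_diff)
qed

lemma adjacent_iff:
  assumes "n \<ge> 3" "j \<in> {1..n}" "k \<in> {1..n}"
  shows "adjacent n (r, j) (s, k) \<longleftrightarrow>
    (r = s \<and> (j = next_col n k \<or> k = next_col n j)) \<or> (j = k \<and> (r = s + 1 \<or> s = r + 1))"
proof -
  have "[int j - int k = -1] (mod int n) \<longleftrightarrow> [int k - int j = 1] (mod int n)"
    using cong_minus_minus_iff[of "int k - int j" 1 "int n"] by simp
  moreover have "\<bar>int r - int s\<bar> = 1 \<longleftrightarrow> r = s + 1 \<or> s = r + 1" by auto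
  ultimately show ?thesis
    using assms by (simp only: adjacent_def fst_conv snd_conv cong_1_iff_next_col)
qed

lemma symp_adjacent: "symp (adjacent n)"
proof (rule sympI)
  fix x y assume "adjacent n x y"
  moreover have "[b - a = c] (mod int n) \<longleftrightarrow> [a - b = - c] (mod int n)" for a b c
    using cong_minus_minus_iff[of "b - a" c "int n"] by simp
  ultimately show "adjacent n y x"
    unfolding adjacent_def by (smt (verit) abs_minus_commute minus_minus)
qed

lemma independent_sets_eq_indep: "independent_sets m n = indep (adjacent n) ({1..m} \<times> {1..n})"
  by (simp add: independent_sets_def indep_def vertices_def)

lemma Z_eq_indep_sum: "Z m n = indep_sum (adjacent n) ({1..m} \<times> {1..n})"
  by (simp add: Z_def indep_sum_def independent_sets_eq_indep)

section \<open>Grids whose top row is thinned out modulo 3\<close>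

definition grid_top_not3 :: "nat \<Rightarrow> nat \<Rightarrow> nat \<Rightarrow> vertex set" where
  "grid_top_not3 n r m = {(i, j). i \<in> {r..m} \<and> j \<in> {1..n} \<and> (i = r \<longrightarrow> \<not> 3 dvd j)}"

definition grid_top_3 :: "nat \<Rightarrow> nat \<Rightarrow> nat \<Rightarrow> vertex set" where
  "grid_top_3 n r m = {(i, j). i \<in> {r..m} \<and> j \<in> {1..n} \<and> (i = r \<longrightarrow> 3 dvd j)}"

lemma finite_grid_top_not3: "finite (grid_top_not3 n r m)" and finite_grid_top_3: "finite (grid_top_3 n r m)"
  by (auto intro: finite_subset[of _ "{r..m} \<times> {1..n}"] simp: grid_top_not3_def grid_top_3_def)

lemma not_3_dvd_cases:
  assumes "j \<in> {1..3 * t}" "\<not> 3 dvd (j::nat)"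
  obtains a where "a < t" "j = 3 * a + 1" | a where "a < t" "j = 3 * a + 2"
proof -
  have "j = 3 * (j div 3) + 1 \<or> j = 3 * (j div 3) + 2"
    using assms(2) by presburger
  moreover have "j div 3 < t" using assms calculation by auto
  ultimately show thesis using that by blast
qed

text \<open>In a top row without the multiples of 3, the columns \<open>3a + 1\<close> and \<open>3a + 2\<close> form an edge that is
  joined to the rest only downwards; the cycle is not noticed, as column \<open>n\<close> is missing.\<close>

lemma adjacent_top_not3:
  assumes "n = 3 * t" "a < t" "i \<ge> r" "l \<in> {1..n}" "i = r \<Longrightarrow> \<not> 3 dvd l"
  shows "adjacent n (r, 3 * a + 1) (i, l) \<longleftrightarrow> (i = r \<and> l = 3 * a + 2) \<or> (i = r + 1 \<and> l = 3 * a + 1)"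
    and "adjacent n (r, 3 * a + 2) (i, l) \<longleftrightarrow> (i = r \<and> l = 3 * a + 1) \<or> (i = r + 1 \<and> l = 3 * a + 2)"
proof -
  have n: "n \<ge> 3" "3 * a + 1 \<in> {1..n}" "3 * a + 2 \<in> {1..n}" using assms by auto
  have nd: "l \<noteq> n" "l \<noteq> 3 * a" "l \<noteq> 3 * a + 3" if "i = r"
    using assms(5)[OF that] assms(1) by auto
  show "adjacent n (r, 3 * a + 1) (i, l) \<longleftrightarrow> (i = r \<and> l = 3 * a + 2) \<or> (i = r + 1 \<and> l = 3 * a + 1)"
    unfolding adjacent_iff[OF n(1,2) assms(4)] using nd assms(1-4) by (auto simp: next_col_def split: if_splits)
  show "adjacent n (r, 3 * a + 2) (i, l) \<longleftrightarrow> (i = r \<and> l = 3 * a + 1) \<or> (i = r + 1 \<and> l = 3 * a + 2)"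
    unfolding adjacent_iff[OF n(1,3) assms(4)] using nd assms(1-4) by (auto simp: next_col_def split: if_splits)
qed

text \<open>The two neighbours of the top vertex in column \<open>3a + 2\<close> are its partner in column \<open>3a + 1\<close> and
  the vertex below itself; both are adjacent to the vertex below the partner, which can therefore
  be deleted. The same holds with the columns exchanged. After these deletions the top row consists
  of \<open>n / 3\<close> isolated edges, an odd number.\<close>

lemma indep_sum_grid_top_not3:
  assumes n: "odd n" "3 dvd n" and "r \<le> m"
  shows "indep_sum (adjacent n) (grid_top_not3 n r m) = - indep_sum (adjacent n) (grid_top_3 n (r + 1) m)"
proof -
  obtain t where t: "n = 3 * t" using n by auto
  have "odd t" using n t by simp
  then have n3: "n \<ge> 3" "t > 0" using t by (auto elim: oddE)
  let ?V = "{(i, j). i = r + 1 \<and> i \<le> m \<and> j \<in> {1..n} \<and> \<not> 3 dvd j}"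
  let ?p = "\<lambda>a. (r, 3 * a + 1)" and ?q = "\<lambda>a. (r, 3 * a + 2)"
  have nb: "adjacent n (?p a) w \<longleftrightarrow> w = ?q a \<or> w = (r + 1, 3 * a + 1)"
      "adjacent n (?q a) w \<longleftrightarrow> w = ?p a \<or> w = (r + 1, 3 * a + 2)"
    if "w \<in> grid_top_not3 n r m" "a < t" for a w
    using that adjacent_top_not3[OF t that(2), of r "fst w" "snd w"] by (cases w; auto simp: grid_top_not3_def)+
  have "indep_sum (adjacent n) (grid_top_not3 n r m) = indep_sum (adjacent n) (grid_top_not3 n r m - ?V)"
  proof (rule indep_sum_fold[OF finite_grid_top_not3 symp_adjacent])
    fix v assume "v \<in> ?V"
    then obtain j where v: "v = (r + 1, j)" "r + 1 \<le> m" "j \<in> {1..3 * t}" "\<not> 3 dvd j" using t by auto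
    have vY: "v \<in> grid_top_not3 n r m" using v t by (auto simp: grid_top_not3_def)
    obtain a k where a: "a < t" "(j = 3 * a + 1 \<and> k = 3 * a + 2) \<or> (j = 3 * a + 2 \<and> k = 3 * a + 1)"
      using v(3,4) by (elim not_3_dvd_cases) auto
    have "\<not> 3 dvd k" using a(2) by presburger
    then have k: "(r, k) \<in> grid_top_not3 n r m" "k \<in> {1..n}" "j \<in> {1..n}"
      using a t \<open>r \<le> m\<close> by (auto simp: grid_top_not3_def)
    show "\<exists>u\<in>grid_top_not3 n r m - ?V. \<not> adjacent n u u \<and> \<not> adjacent n u v \<and>
        (\<forall>w\<in>grid_top_not3 n r m. adjacent n u w \<longrightarrow> adjacent n v w)"
    proof (rule bexI[of _ "(r, k)"], intro conjI ballI impI)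
      show "\<not> adjacent n (r, k) (r, k)" "\<not> adjacent n (r, k) v"
        using nb[OF k(1) a(1)] nb[OF vY a(1)] a(2) v by auto
      show "(r, k) \<in> grid_top_not3 n r m - ?V" using k by auto
      fix w assume w: "w \<in> grid_top_not3 n r m" "adjacent n (r, k) w"
      then have "w = (r, j) \<or> w = (r + 1, k)" using nb[OF w(1) a(1)] a(2) by auto
      then show "adjacent n v w"
        using n3(1) k(2,3) a(2) v(1) by (auto simp: adjacent_iff next_col_def)
    qed
  qed
  also have "grid_top_not3 n r m - ?V = ?p ` {..<t} \<union> ?q ` {..<t} \<union> grid_top_3 n (r + 1) m"
  proof
    show "grid_top_not3 n r m - ?V \<subseteq> ?p ` {..<t} \<union> ?q ` {..<t} \<union> grid_top_3 n (r + 1) m"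
    proof
      fix w assume w: "w \<in> grid_top_not3 n r m - ?V"
      obtain i j where ij: "w = (i, j)" by fastforce
      show "w \<in> ?p ` {..<t} \<union> ?q ` {..<t} \<union> grid_top_3 n (r + 1) m"
      proof (cases "i = r")
        case True
        then have "j \<in> {1..3 * t}" "\<not> 3 dvd j" using w ij t by (auto simp: grid_top_not3_def)
        then show ?thesis using True ij by (elim not_3_dvd_cases) auto
      qed (use w ij in \<open>auto simp: grid_top_not3_def grid_top_3_def\<close>)
    qed
    show "?p ` {..<t} \<union> ?q ` {..<t} \<union> grid_top_3 n (r + 1) m \<subseteq> grid_top_not3 n r m - ?V"
      using t \<open>r \<le> m\<close> by (auto simp: grid_top_not3_def grid_top_3_def; presburger?)
  qed
  also have "indep_sum (adjacent n) \<dots> = (-1) ^ card {..<t} * indep_sum (adjacent n) (grid_top_3 n (r + 1) m)"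
  proof (rule indep_sum_isolated_edges[OF _ finite_grid_top_3 symp_adjacent])
    have sub: "?p ` {..<t} \<union> ?q ` {..<t} \<union> grid_top_3 n (r + 1) m \<subseteq> grid_top_not3 n r m"
      "(r + 1, 3 * a + 1) \<notin> ?p ` {..<t} \<union> ?q ` {..<t} \<union> grid_top_3 n (r + 1) m"
      "(r + 1, 3 * a + 2) \<notin> ?p ` {..<t} \<union> ?q ` {..<t} \<union> grid_top_3 n (r + 1) m" for a
      using t \<open>r \<le> m\<close> by (auto simp: grid_top_not3_def grid_top_3_def; presburger?)+
    fix a assume a: "a \<in> {..<t}"
    show "w = ?q a" if "w \<in> ?p ` {..<t} \<union> ?q ` {..<t} \<union> grid_top_3 n (r + 1) m" "adjacent n (?p a) w" for w
      using nb(1)[of w a] sub that a by blast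
    show "w = ?p a" if "w \<in> ?p ` {..<t} \<union> ?q ` {..<t} \<union> grid_top_3 n (r + 1) m" "adjacent n (?q a) w" for w
      using nb(2)[of w a] sub that a by blast
    show "adjacent n (?p a) (?q a)"
      using nb(1)[of "?q a" a] sub(1) a by blast
  next
    have "3 * x + 1 \<noteq> 3 * y + 2" for x y :: nat by presburger
    then show "?p ` {..<t} \<inter> ?q ` {..<t} = {}" by auto
  qed (auto simp: inj_on_def grid_top_3_def)
  finally show ?thesis using \<open>odd t\<close> by simp
qed

text \<open>Here a top vertex has the vertex below it as its only neighbour. All other neighbours of
  that vertex can be deleted, which leaves \<open>n / 3\<close> isolated vertical edges, and below
  them a row without the multiples of 3. If there is no row below the top one, its vertices are
  isolated and the sum vanishes.\<close>

lemma indep_sum_grid_top_3: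
  assumes n: "odd n" "3 dvd n" and "r \<le> m"
  shows "indep_sum (adjacent n) (grid_top_3 n r m) =
    (if r = m then 0 else - indep_sum (adjacent n) (grid_top_not3 n (r + 2) m))"
proof -
  obtain t where t: "n = 3 * t" using n by auto
  have "odd t" using n t by simp
  then have n3: "n \<ge> 3" "t > 0" using t by (auto elim: oddE)
  have next_not_mult: "\<not> 3 dvd next_col n k" if "3 dvd k" for k
    using that n3 by (auto simp: next_col_def) presburger
  have nb: "adjacent n (r, j) w \<longleftrightarrow> w = (r + 1, j)" if w: "w \<in> grid_top_3 n r m" and j: "j \<in> {1..n}" "3 dvd j" for w j
  proof -
    obtain i l where il: "w = (i, l)" "i \<ge> r" "l \<in> {1..n}" "i = r \<Longrightarrow> 3 dvd l"
      using w by (auto simp: grid_top_3_def)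
    show ?thesis
      unfolding il(1) adjacent_iff[OF n3(1) j(1) il(3)] using il(2-) j next_not_mult by auto
  qed
  show ?thesis
  proof (cases "r = m")
    case True
    have "indep_sum (adjacent n) (grid_top_3 n r m) = 0"
    proof (rule indep_sum_isolated_vertex[OF finite_grid_top_3 symp_adjacent])
      show "(r, n) \<in> grid_top_3 n r m" using True n n3 by (auto simp: grid_top_3_def)
      show "\<not> adjacent n (r, n) w" if "w \<in> grid_top_3 n r m" for w
        using nb[OF that] n n3 that True by (auto simp: grid_top_3_def)
    qed
    then show ?thesis using True by simp
  next
    case False
    let ?V = "{(i, j) \<in> grid_top_3 n r m. (i = r + 1 \<and> \<not> 3 dvd j) \<or> (i = r + 2 \<and> 3 dvd j)}"
    let ?p = "\<lambda>a. (r, 3 * a + 3)" and ?q = "\<lambda>a. (r + 1, 3 * a + 3)"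
    have mult: "j \<in> {1..n} \<and> 3 dvd j \<longleftrightarrow> (\<exists>a<t. j = 3 * a + 3)" for j
    proof
      assume "j \<in> {1..n} \<and> 3 dvd j"
      then obtain b where b: "j = 3 * b" "b \<ge> 1" "b \<le> t" using t by (auto elim!: dvdE)
      then have "b - 1 < t \<and> j = 3 * (b - 1) + 3" by auto
      then show "\<exists>a<t. j = 3 * a + 3" by blast
    next
      assume "\<exists>a<t. j = 3 * a + 3"
      then obtain a where "a < t" "j = 3 * a + 3" by blast
      then have "j = 3 * (a + 1)" "j \<in> {1..n}" using t by auto
      then show "j \<in> {1..n} \<and> 3 dvd j" by (metis dvd_triv_left)
    qed
    have "indep_sum (adjacent n) (grid_top_3 n r m) = indep_sum (adjacent n) (grid_top_3 n r m - ?V)"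
    proof (rule indep_sum_fold[OF finite_grid_top_3 symp_adjacent])
      fix v assume v: "v \<in> ?V"
      then have "snd v \<in> {1..n}" by (auto simp: grid_top_3_def)
      have "\<exists>j. j \<in> {1..n} \<and> 3 dvd j \<and> v \<noteq> (r + 1, j) \<and> adjacent n v (r + 1, j)"
      proof (cases "fst v = r + 1")
        case True
        then obtain l where l: "v = (r + 1, l)" "l \<in> {1..3 * t}" "\<not> 3 dvd l"
          using v t by (auto simp: grid_top_3_def)
        from l(2,3) show ?thesis
        proof (cases rule: not_3_dvd_cases)
          case (1 a)
          show ?thesis
          proof (cases "a = 0")
            \<comment> \<open>The only place where the cycle closes: column 1 is next to column \<open>n\<close>.\<close>
            case True
            then show ?thesis
              using 1 l n n3 by (intro exI[of _ n]) (auto simp: adjacent_iff next_col_def)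
          next
            case False
            then show ?thesis
              using 1 l n n3 t by (intro exI[of _ "3 * a"]) (auto simp: adjacent_iff next_col_def)
          qed
        next
          case (2 a)
          then have "3 * a + 3 \<in> {1..n} \<and> 3 dvd 3 * a + 3" by (simp only: mult) blast
          then show ?thesis
            using 2 l n n3 t by (intro exI[of _ "3 * a + 3"]) (auto simp: adjacent_iff next_col_def)
        qed
      next
        case False
        then obtain l where "v = (r + 2, l)" "l \<in> {1..n}" "3 dvd l"
          using v by (auto simp: grid_top_3_def)
        then show ?thesis
          using n3 by (intro exI[of _ l]) (auto simp: adjacent_iff)
      qed
      then obtain j where j: "j \<in> {1..n}" "3 dvd j" "v \<noteq> (r + 1, j)" "adjacent n v (r + 1, j)" by blast
      have rj: "(r, j) \<in> grid_top_3 n r m" using j \<open>r \<le> m\<close> by (auto simp: grid_top_3_def)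
      show "\<exists>u\<in>grid_top_3 n r m - ?V. \<not> adjacent n u u \<and> \<not> adjacent n u v \<and>
          (\<forall>w\<in>grid_top_3 n r m. adjacent n u w \<longrightarrow> adjacent n v w)"
      proof (rule bexI[of _ "(r, j)"], intro conjI ballI impI)
        show "\<not> adjacent n (r, j) (r, j)" using nb[OF rj] j by auto
        show "\<not> adjacent n (r, j) v" using nb[of v j] j v by auto
        show "(r, j) \<in> grid_top_3 n r m - ?V" using rj by auto
        show "adjacent n v w" if "w \<in> grid_top_3 n r m" "adjacent n (r, j) w" for w
          using nb[of w j] that j by simp
      qed
    qed
    also have "grid_top_3 n r m - ?V = ?p ` {..<t} \<union> ?q ` {..<t} \<union> grid_top_not3 n (r + 2) m" (is "_ = ?R")
    proof
      show "grid_top_3 n r m - ?V \<subseteq> ?R"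
      proof
        fix w assume w: "w \<in> grid_top_3 n r m - ?V"
        then obtain i j where ij: "w = (i, j)" "i \<in> {r..m}" "j \<in> {1..n}" "i \<in> {r, r + 1} \<Longrightarrow> 3 dvd j"
          "i = r + 2 \<Longrightarrow> \<not> 3 dvd j"
          by (auto simp: grid_top_3_def)
        show "w \<in> ?R"
        proof (cases "i \<in> {r, r + 1}")
          case True
          then obtain a where "a < t" "j = 3 * a + 3" using mult ij by blast
          then show ?thesis using True ij by auto
        qed (use ij in \<open>auto simp: grid_top_not3_def\<close>)
      qed
      have "(i, 3 * a + 3) \<in> grid_top_3 n r m - ?V" if "a < t" "i \<in> {r, r + 1}" for a i
      proof -
        have "3 * a + 3 \<in> {1..n}" "3 dvd 3 * a + 3" using mult that by blast+
        then show ?thesis using that \<open>r \<le> m\<close> False by (auto simp: grid_top_3_def)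
      qed
      then show "?R \<subseteq> grid_top_3 n r m - ?V"
        by (auto simp: grid_top_3_def grid_top_not3_def)
    qed
    also have "indep_sum (adjacent n) \<dots> = (-1) ^ card {..<t} * indep_sum (adjacent n) (grid_top_not3 n (r + 2) m)"
    proof (rule indep_sum_isolated_edges[OF _ finite_grid_top_not3 symp_adjacent])
      fix a assume a: "a \<in> {..<t}"
      then have a3: "3 * a + 3 \<in> {1..n}" "3 dvd 3 * a + 3" using mult by blast+
      show "adjacent n (?p a) (?q a)" using adjacent_iff[OF n3(1) a3(1) a3(1)] by simp
      have sub: "?R \<subseteq> grid_top_3 n r m"
      proof -
        have "(i, 3 * a + 3) \<in> grid_top_3 n r m" if "a < t" "i \<in> {r, r + 1}" for a i
        proof -
          have "3 * a + 3 \<in> {1..n}" "3 dvd 3 * a + 3" using mult that by blast+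
          then show ?thesis using that \<open>r \<le> m\<close> False by (auto simp: grid_top_3_def)
        qed
        then show ?thesis by (auto simp: grid_top_3_def grid_top_not3_def)
      qed
      show "w = ?q a" if "w \<in> ?R" "adjacent n (?p a) w" for w
        using nb[of w "3 * a + 3"] a3 sub that by blast
      show "w = ?p a" if w: "w \<in> ?R" and adj: "adjacent n (?q a) w" for w
      proof -
        obtain i l where w_eq: "w = (i, l)" by fastforce
        have il: "i \<ge> r" "l \<in> {1..n}" using w sub unfolding w_eq by (auto simp: grid_top_3_def)
        have il3: "3 dvd l" if "i \<le> r + 1"
        proof -
          have "w \<notin> grid_top_not3 n (r + 2) m" using that w_eq by (auto simp: grid_top_not3_def)
          then obtain a' where "a' < t" "l = 3 * a' + 3" using w w_eq by blast
          then show ?thesis using mult by blast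
        qed
        have il2: "\<not> 3 dvd l" if "i = r + 2"
          using w w_eq that by (auto simp: grid_top_not3_def)
        have "\<not> (i = r + 1 \<and> (3 * a + 3 = next_col n l \<or> l = next_col n (3 * a + 3)))"
          using next_not_mult[of l] next_not_mult[of "3 * a + 3"] il3 a3(2) by (metis order_refl)
        then have "3 * a + 3 = l \<and> (r + 1 = i + 1 \<or> i = r + 2)"
          using adj unfolding w_eq adjacent_iff[OF n3(1) a3(1) il(2)] by (metis add.assoc one_add_one)
        then show ?thesis using il2 a3(2) w_eq by (metis add_right_cancel)
      qed
    qed (auto simp: inj_on_def grid_top_not3_def)
    finally show ?thesis using \<open>odd t\<close> False by simp
  qed
qed

text \<open>The two reductions combined remove three rows without changing the sum.\<close>

lemma indep_sum_grid_top_not3_closed: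
  assumes n: "odd n" "3 dvd n" and "r \<le> m + 1"
  shows "indep_sum (adjacent n) (grid_top_not3 n r m) =
    (if (m + 1 - r) mod 3 = 0 then 1 else if (m + 1 - r) mod 3 = 1 then -1 else 0)"
  using assms(3)
proof (induction "m + 1 - r" arbitrary: r rule: less_induct)
  case less
  consider "r = m + 1" | "r = m" | "r + 1 = m" | "r + 3 \<le> m + 1" using less.prems by linarith
  then show ?case
  proof cases
    case 4
    then have "indep_sum (adjacent n) (grid_top_not3 n r m) = indep_sum (adjacent n) (grid_top_not3 n (r + 3) m)"
      using indep_sum_grid_top_not3[OF n, of r m] indep_sum_grid_top_3[OF n, of "r + 1" m] by (simp add: numeral_3_eq_3)
    moreover have "indep_sum (adjacent n) (grid_top_not3 n (r + 3) m) =
      (if (m + 1 - (r + 3)) mod 3 = 0 then 1 else if (m + 1 - (r + 3)) mod 3 = 1 then -1 else 0)"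
      using 4 by (intro less.hyps) auto
    moreover have "(m + 1 - (r + 3)) mod 3 = (m + 1 - r) mod 3"
    proof -
      have "m + 1 - r = (m + 1 - (r + 3)) + 3" using 4 by simp
      then show ?thesis by (metis mod_add_self2)
    qed
    ultimately show ?thesis by (simp only:)
  qed (use indep_sum_grid_top_not3[OF n, of r m] indep_sum_grid_top_3[OF n, of "r + 1" m] in \<open>auto simp: grid_top_not3_def grid_top_3_def\<close>)
qed

section \<open>Cyclic gaps\<close>

text \<open>The distance from a column back to itself is a full turn, \<open>n\<close>, and not 0, so that a single
  occupied column bounds one gap of length \<open>n\<close>.\<close>

definition back_dist :: "nat \<Rightarrow> nat \<Rightarrow> nat \<Rightarrow> nat" where
  "back_dist n k j = (if k < j then j - k else j + n - k)"

definition gap :: "nat \<Rightarrow> nat set \<Rightarrow> nat \<Rightarrow> nat" where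
  "gap n J j = Min ((\<lambda>k. back_dist n k j) ` J)"

lemma back_dist_self [simp]: "back_dist n j j = n"
  by (simp add: back_dist_def)

lemma back_dist_pos: "k \<in> {1..n} \<Longrightarrow> j \<in> {1..n} \<Longrightarrow> back_dist n k j > 0"
  by (auto simp: back_dist_def)

lemma back_dist_next_col:
  assumes "k \<in> {1..n}" "j \<in> {1..n}"
  shows "back_dist n k (next_col n j) = (if k = j then 1 else back_dist n k j + 1)"
  using assms by (auto simp: back_dist_def next_col_def)

lemma gap_le: "finite J \<Longrightarrow> k \<in> J \<Longrightarrow> gap n J j \<le> back_dist n k j"
  by (simp add: gap_def)

lemma gap_attained:
  assumes "finite J" "J \<noteq> {}"
  obtains k where "k \<in> J" "back_dist n k j = gap n J j"
proof -
  have "gap n J j \<in> (\<lambda>k. back_dist n k j) ` J"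
    unfolding gap_def using assms by (intro Min_in) auto
  then show thesis using that by (elim imageE) simp
qed

lemma gap_eqI:
  assumes "finite J" "k \<in> J" "back_dist n k j = d" "\<And>i. i \<in> J \<Longrightarrow> d \<le> back_dist n i j"
  shows "gap n J j = d"
  unfolding gap_def using assms by (intro Min_eqI) auto

lemma gap_insert:
  "finite J \<Longrightarrow> J \<noteq> {} \<Longrightarrow> gap n (insert x J) j = min (back_dist n x j) (gap n J j)"
  by (simp add: gap_def)

lemma gap_singleton_self [simp]: "gap n {x} x = n"
  by (simp add: gap_def)

lemma gap_pos:
  assumes "J \<subseteq> {1..n}" "J \<noteq> {}" "j \<in> {1..n}"
  shows "gap n J j > 0"
proof -
  have "finite J" using assms(1) finite_subset by blast
  then obtain k where "k \<in> J" "back_dist n k j = gap n J j" using gap_attained assms(2) by metis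
  then show ?thesis using back_dist_pos[of k n j] assms by auto
qed

lemma gap_next_col:
  assumes J: "J \<subseteq> {1..n}" "J \<noteq> {}" and j: "j \<in> {1..n}"
  shows "gap n J (next_col n j) = (if j \<in> J then 1 else gap n J j + 1)"
proof -
  have fin: "finite J" using J(1) finite_subset by blast
  show ?thesis
  proof (cases "j \<in> J")
    case True
    have "gap n J (next_col n j) = 1"
      using J j True by (intro gap_eqI[OF fin True]) (auto simp: back_dist_next_col subset_iff)
    then show ?thesis using True by simp
  next
    case False
    obtain k where k: "k \<in> J" "back_dist n k j = gap n J j" using gap_attained fin J(2) by metis
    have "gap n J (next_col n j) = gap n J j + 1"
    proof (rule gap_eqI[OF fin k(1)])
      show "back_dist n k (next_col n j) = gap n J j + 1"
        using k False J j by (auto simp: back_dist_next_col subset_iff)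
      show "gap n J j + 1 \<le> back_dist n i (next_col n j)" if "i \<in> J" for i
      proof -
        have "i \<noteq> j" "i \<in> {1..n}" using that False J by auto
        then show ?thesis using gap_le[OF fin that, of n j] j by (simp add: back_dist_next_col)
      qed
    qed
    then show ?thesis using False by simp
  qed
qed

text \<open>Inserting \<open>x\<close> affects only the gaps of the columns between \<open>x\<close> and the next element of \<open>J\<close>,
  and each of them decreases by the even gap of \<open>x\<close>.\<close>

lemma even_gap_insert:
  assumes J: "J \<subseteq> {1..n}" "J \<noteq> {}" and x: "x \<in> {1..n}" "x \<notin> J" "even (gap n J x)"
    and j: "j \<in> {1..n}"
  shows "even (gap n (insert x J) j) \<longleftrightarrow> even (gap n J j)"
proof -
  have fin: "finite J" using J(1) finite_subset by blast
  show ?thesis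
  proof (cases "back_dist n x j < gap n J j")
    case False
    then show ?thesis using gap_insert[OF fin J(2)] by (simp add: min_def)
  next
    case True
    have gap_split: "back_dist n i x + back_dist n x j = back_dist n i j" if "i \<in> J" for i
      using gap_le[OF fin that, of n j] True that J x(1,2) j
      by (auto simp: back_dist_def subset_iff split: if_splits)
    obtain k where k: "k \<in> J" "back_dist n k j = gap n J j" using gap_attained fin J(2) by metis
    have "gap n J x = gap n J j - back_dist n x j"
    proof (rule gap_eqI[OF fin k(1)])
      show "back_dist n k x = gap n J j - back_dist n x j" using gap_split[OF k(1)] k(2) by simp
      show "gap n J j - back_dist n x j \<le> back_dist n i x" if "i \<in> J" for i
        using gap_split[OF that] gap_le[OF fin that, of n j] by simp
    qed
    then have "gap n J j = gap n J x + back_dist n x j" using True by simp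
    then show ?thesis using True x(3) gap_insert[OF fin J(2)] by (simp add: min_def)
  qed
qed

text \<open>Deleting \<open>x\<close> is undone by inserting it, and its own gap does not see whether it belongs to the
  set, unless it is the only element. That case is excluded by parity: the gap would be \<open>n\<close>.\<close>

lemma toggle_even_gap:
  assumes "odd n" and J: "J \<subseteq> {1..n}" "J \<noteq> {}" and x: "x \<in> {1..n}" "even (gap n J x)"
  shows "toggle x J \<noteq> {}"
    and "j \<in> {1..n} \<Longrightarrow> even (gap n (toggle x J) j) \<longleftrightarrow> even (gap n J j)"
proof -
  have fin: "finite J" using J(1) finite_subset by blast
  have "J \<noteq> {x}" using x(2) \<open>odd n\<close> by auto
  then show ne: "toggle x J \<noteq> {}" using J(2) by (auto simp: toggle_def)
  assume j: "j \<in> {1..n}"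
  show "even (gap n (toggle x J) j) \<longleftrightarrow> even (gap n J j)"
  proof (cases "x \<in> J")
    case False
    then show ?thesis using even_gap_insert[OF J x(1) False x(2) j] by (simp add: toggle_def)
  next
    case True
    define K where "K = J - {x}"
    have K: "J = insert x K" "x \<notin> K" "K \<noteq> {}" "K \<subseteq> {1..n}" "finite K"
      using True ne J fin by (auto simp: K_def toggle_def)
    have "gap n J x = gap n K x"
    proof -
      obtain k where "k \<in> K" "back_dist n k x = gap n K x" using gap_attained K(3,5) by metis
      then have "gap n K x \<le> n" using K(2,4) x(1) by (auto simp: back_dist_def subset_iff split: if_splits)
      then show ?thesis unfolding K(1) gap_insert[OF K(5,3)] by simp
    qed
    moreover have "toggle x J = K" using True by (simp add: toggle_def K_def)
    ultimately show ?thesis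
      using even_gap_insert[OF K(4,3) x(1) K(2) _ j] x(2) K(1) by simp
  qed
qed

lemma not_both_even_gap:
  assumes "J \<subseteq> {1..n}" "J \<noteq> {}" "j \<in> {1..n}" "even (gap n J j)"
  shows "odd (gap n J (next_col n j))"
  using gap_next_col[OF assms(1-3)] assms(4) by simp

definition residue_cols :: "nat \<Rightarrow> nat \<Rightarrow> nat set" where
  "residue_cols n c = {j \<in> {1..n}. j mod 3 = c}"

text \<open>Stepping back by 3 stays in \<open>J\<close>, and \<open>J\<close> has at most one element among the columns 1, 2, 3;
  hence all elements are congruent to it. The step back from that element wraps around to
  the column \<open>n - 3\<close> higher, which forces 3 to divide \<open>n\<close>; descending from there reaches the whole
  residue class.\<close>

lemma all_gaps_3:
  assumes J: "J \<subseteq> {1..n}" "J \<noteq> {}" and n: "n \<ge> 3" and gap3: "\<And>j. j \<in> J \<Longrightarrow> gap n J j = 3"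
  shows "3 dvd n" "\<exists>c<3. J = residue_cols n c"
proof -
  have fin: "finite J" using J(1) finite_subset by blast
  have pred: "(if j > 3 then j - 3 else j + n - 3) \<in> J" if "j \<in> J" for j
  proof -
    have "gap n J j = 3" by (rule gap3[OF that])
    then obtain k where k: "k \<in> J" "back_dist n k j = 3" using gap_attained[OF fin J(2)] by metis
    moreover have "j \<in> {1..n}" "k \<in> {1..n}" using that k J by auto
    ultimately have "k = (if j > 3 then j - 3 else j + n - 3)"
      by (auto simp: back_dist_def split: if_splits)
    then show ?thesis using k by simp
  qed
  have far: "\<not> (a < b \<and> b < a + 3)" if "a \<in> J" "b \<in> J" for a b
    using gap_le[OF fin that(1), of n b] gap3[OF that(2)] by (auto simp: back_dist_def)
  obtain j0 where j0: "j0 \<in> J" using J(2) by blast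
  have down: "j - 3 * i \<in> J" if "j \<in> J" "j > 3 * i" for i j
    using that(2)
  proof (induction i)
    case (Suc i)
    then show ?case using pred[of "j - 3 * i"] by (simp add: add.commute split: if_splits)
  qed (use that in simp)
  \<comment> \<open>\<open>b j\<close> is the representative of \<open>j\<close> modulo 3 among 1, 2, 3.\<close>
  define b where "b j = (j - 1) mod 3 + 1" for j :: nat
  have block: "j = 3 * ((j - 1) div 3) + b j" "b j \<in> {1..3}" "j mod 3 = b j mod 3" if "j \<ge> 1" for j
  proof -
    have "3 * ((j - 1) div 3) + (j - 1) mod 3 = j - 1" by (rule mult_div_mod_eq)
    then show *: "j = 3 * ((j - 1) div 3) + b j" unfolding b_def using that by linarith
    show "b j \<in> {1..3}" by (simp add: b_def Suc_le_eq)
    show "j mod 3 = b j mod 3" by (subst *) simp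
  qed
  have J1: "j \<ge> 1" if "j \<in> J" for j using that J by auto
  have bJ: "b j \<in> J" if "j \<in> J" for j
  proof -
    have "j - 3 * ((j - 1) div 3) \<in> J"
      using block(1,2)[OF J1[OF that]] by (intro down[OF that]) auto
    moreover have "j - 3 * ((j - 1) div 3) = b j" using block(1)[OF J1[OF that]] by linarith
    ultimately show ?thesis by simp
  qed
  have beq: "b j = b j0" if "j \<in> J" for j
    using far[OF bJ[OF that] bJ[OF j0]] far[OF bJ[OF j0] bJ[OF that]]
      block(2)[OF J1[OF that]] block(2)[OF J1[OF j0]] by auto
  have b0: "b j0 \<in> {1..3}" by (rule block(2)[OF J1[OF j0]])
  let ?t = "b j0 + n - 3"
  have t: "?t \<in> J" using pred[OF bJ[OF j0]] b0 n by (auto split: if_splits)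
  have "?t mod 3 = b j0 mod 3" using block(3)[OF J1[OF t]] beq[OF t] by simp
  moreover have "?t + 3 = b j0 + n" using n by simp
  ultimately have "(b j0 + n) mod 3 = b j0 mod 3" by (metis mod_add_self2)
  then have "[b j0 + n = b j0] (mod 3)" by (simp add: cong_def)
  then show "3 dvd n" by (simp add: cong_add_lcancel_0_nat cong_0_iff)
  then obtain u where u: "n = 3 * u" by (elim dvdE)
  have "J = residue_cols n (b j0 mod 3)"
  proof
    show "J \<subseteq> residue_cols n (b j0 mod 3)"
    proof
      fix j assume "j \<in> J"
      then show "j \<in> residue_cols n (b j0 mod 3)"
        using J(1) block(3)[OF J1] beq by (auto simp: residue_cols_def)
    qed
    show "residue_cols n (b j0 mod 3) \<subseteq> J"
    proof
      fix j assume "j \<in> residue_cols n (b j0 mod 3)"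
      then have j: "j \<ge> 1" "j \<le> n" "j mod 3 = b j0 mod 3" by (auto simp: residue_cols_def)
      have "x = y" if "x \<in> {1..3}" "y \<in> {1..3}" "x mod 3 = y mod 3" for x y :: nat
      proof -
        have "x = 1 \<or> x = 2 \<or> x = 3" "y = 1 \<or> y = 2 \<or> y = 3" using that(1,2) by auto
        then show ?thesis using that(3) by auto
      qed
      then have "b j = b j0" using block(2,3)[OF j(1)] b0 j(3) by metis
      then have q: "j = 3 * ((j - 1) div 3) + b j0" using block(1)[OF j(1)] by simp
      define i where "i = u - 1 - (j - 1) div 3"
      have "(j - 1) div 3 < u" using q j(2) u b0 by auto
      then have "?t = j + 3 * i" using q u unfolding i_def by linarith
      then show "j \<in> J" using down[OF t, of i] j(1) by simp
    qed
  qed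
  then show "\<exists>c<3. J = residue_cols n c" by (intro exI[of _ "b j0 mod 3"]) auto
qed

text \<open>Even gaps of a residue class are equal to 2, and the column two steps after an element comes
  just before the next one. This is why a first row equal to a residue class has no active
  columns.\<close>

lemma gap_residue_cols:
  assumes n: "3 dvd n" "n \<ge> 3" and c: "c < 3" and j: "j \<in> {1..n}"
  shows "gap n (residue_cols n c) j \<le> 3"
    and "j \<in> residue_cols n c \<Longrightarrow> gap n (residue_cols n c) j = 3"
    and "even (gap n (residue_cols n c) j) \<Longrightarrow> next_col n j \<in> residue_cols n c"
proof -
  have fin: "finite (residue_cols n c)" by (simp add: residue_cols_def)
  have n0: "(x + n) mod 3 = x mod 3" for x using n(1) by (auto elim!: dvdE)
  have dist: "(back_dist n k j + k) mod 3 = j mod 3" if "k \<in> {1..n}" for k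
  proof -
    have "back_dist n k j + k = j \<or> back_dist n k j + k = j + n" using that by (auto simp: back_dist_def)
    then show ?thesis using n0 by metis
  qed
  obtain d where d: "d \<in> {1,2,3}" "(c + d) mod 3 = j mod 3"
  proof -
    have "c = 0 \<or> c = 1 \<or> c = 2" "j mod 3 = 0 \<or> j mod 3 = 1 \<or> j mod 3 = 2" using c by auto
    then have "(c + 1) mod 3 = j mod 3 \<or> (c + 2) mod 3 = j mod 3 \<or> (c + 3) mod 3 = j mod 3" by auto
    then show thesis using that by blast
  qed
  define k where "k = (if d < j then j - d else j + n - d)"
  have k_range: "k \<in> {1..n}" and k_dist: "back_dist n k j = d"
    using d(1) j n(2) by (auto simp: k_def back_dist_def)
  have "(d + k) mod 3 = (d + c) mod 3" using dist[OF k_range] k_dist d(2) by (simp add: add.commute)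
  then have "k mod 3 = c" using c cong_add_lcancel_nat[of d k c 3] by (simp add: cong_def)
  then have k: "k \<in> residue_cols n c" using k_range by (simp add: residue_cols_def)
  show le3: "gap n (residue_cols n c) j \<le> 3"
    using gap_le[OF fin k, of n j] k_dist d(1) by auto
  define g where "g = gap n (residue_cols n c) j"
  obtain i where i: "i \<in> residue_cols n c" "back_dist n i j = g"
    using gap_attained[OF fin, of n j] k unfolding g_def by blast
  have pos: "g > 0"
    using k j unfolding g_def by (intro gap_pos) (auto simp: residue_cols_def)
  have gi: "(g + i) mod 3 = j mod 3" "i mod 3 = c"
    using dist[of i] i by (auto simp: residue_cols_def)
  show "gap n (residue_cols n c) j = 3" if "j \<in> residue_cols n c"
  proof -
    have "(g + i) mod 3 = i mod 3" using gi that by (simp add: residue_cols_def)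
    moreover have "g = 1 \<or> g = 2 \<or> g = 3" using le3 pos unfolding g_def by linarith
    ultimately have "g = 3" by presburger
    then show ?thesis by (simp add: g_def)
  qed
  show "next_col n j \<in> residue_cols n c" if "even (gap n (residue_cols n c) j)"
  proof -
    have "g = 1 \<or> g = 2 \<or> g = 3" using le3 pos unfolding g_def by linarith
    then have "g = 2" using that unfolding g_def by auto
    have "next_col n j mod 3 = (j + 1) mod 3"
      using n0[of 1] by (auto simp: next_col_def add.commute)
    also have "\<dots> = (g + i + 1) mod 3" using gi(1) by (metis mod_add_left_eq)
    also have "g + i + 1 = i + 3" using \<open>g = 2\<close> by simp
    also have "(i + 3) mod 3 = i mod 3" by (rule mod_add_self2)
    finally show ?thesis using gi(2) j by (auto simp: residue_cols_def next_col_def)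
  qed
qed

section \<open>Intervals in terms of gaps\<close>

definition cols :: "vertex set \<Rightarrow> nat set" where
  "cols \<sigma> = {j. (1, j) \<in> \<sigma>}"

lemma first_row_eq_image: "first_row \<sigma> = Pair 1 ` cols \<sigma>"
  by (force simp: first_row_def cols_def)

lemma first_row_cols_eq: "first_row_cols \<sigma> = sorted_list_of_set (cols \<sigma>)"
  by (simp add: first_row_cols_def first_row_eq_image image_image)

lemma card_first_row: "card (first_row \<sigma>) = card (cols \<sigma>)"
  by (simp add: first_row_eq_image card_image inj_on_def)

text \<open>Positions in intervals are gaps: each interval starts right after an occupied column and ends at
  the next one. With \<open>intervals_entry_of_col\<close>, which finds every column in some interval, this
  replaces quantification over intervals and positions by quantification over columns.\<close>

lemma interval_entries:
  assumes J: "cols \<sigma> \<subseteq> {1..n}" "cols \<sigma> \<noteq> {}" and i: "i \<in> {1..card (first_row \<sigma>)}"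
  shows "length (interval n \<sigma> i) \<ge> 1"
    and "l \<in> {1..length (interval n \<sigma> i)} \<Longrightarrow>
      \<exists>j\<in>{1..n}. interval n \<sigma> i ! (l - 1) = (1, j) \<and> gap n (cols \<sigma>) j = l \<and>
        (j \<in> cols \<sigma> \<longleftrightarrow> l = length (interval n \<sigma> i))"
proof -
  define js where "js = sorted_list_of_set (cols \<sigma>)"
  have fin: "finite (cols \<sigma>)" using J(1) finite_subset by blast
  have js: "sorted js" "distinct js" "set js = cols \<sigma>" "length js = card (cols \<sigma>)" "js \<noteq> []"
    using fin J(2) by (simp_all add: js_def)
  have ends: "hd js \<in> cols \<sigma>" "last js \<in> cols \<sigma>" using js(3,5) hd_in_set last_in_set by metis+
  have between: "hd js \<le> k" "k \<le> last js" "k \<in> {1..n}" if k: "k \<in> cols \<sigma>" for k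
  proof -
    obtain p where p: "p < length js" "js ! p = k" using k unfolding js(3)[symmetric] in_set_conv_nth by blast
    show "hd js \<le> k" using p js(1,5) by (auto simp: hd_conv_nth intro!: sorted_nth_mono)
    show "k \<le> last js" using p js(1,5) by (auto simp: last_conv_nth intro!: sorted_nth_mono)
    show "k \<in> {1..n}" using that J(1) by auto
  qed
  have "length (interval n \<sigma> i) \<ge> 1 \<and> (l \<in> {1..length (interval n \<sigma> i)} \<longrightarrow>
      (\<exists>j\<in>{1..n}. interval n \<sigma> i ! (l - 1) = (1, j) \<and> gap n (cols \<sigma>) j = l \<and>
        (j \<in> cols \<sigma> \<longleftrightarrow> l = length (interval n \<sigma> i))))"
  proof (cases "i = 1")
    case True
    have int: "interval n \<sigma> i = map (Pair 1) ([last js + 1..<n + 1] @ [1..<hd js + 1])"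
      using True by (simp add: interval_def first_row_cols_eq js_def Let_def)
    have "hd js \<ge> 1" "last js \<le> n" "hd js \<le> last js"
      using between(1)[OF ends(2)] between(3)[OF ends(1)] between(3)[OF ends(2)] by simp_all
    then have len: "length (interval n \<sigma> i) = (n - last js) + hd js"
      by (simp add: int del: upt_Suc)
    show ?thesis
    proof (intro conjI impI)
      show "1 \<le> length (interval n \<sigma> i)" using len \<open>hd js \<ge> 1\<close> by simp
      assume l: "l \<in> {1..length (interval n \<sigma> i)}"
      define j where "j = (if l \<le> n - last js then last js + l else l - (n - last js))"
      have nth: "interval n \<sigma> i ! (l - 1) = (1, j)"
        using l \<open>last js \<le> n\<close> unfolding len int j_def by (auto simp: nth_append simp del: upt_Suc)
      have j: "j \<in> {1..n}" "j > last js \<or> j \<le> hd js"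
        using l \<open>last js \<le> n\<close> \<open>hd js \<le> last js\<close> unfolding len j_def by auto
      have "gap n (cols \<sigma>) j = l"
      proof (rule gap_eqI[OF fin ends(2)])
        show *: "back_dist n (last js) j = l"
          using l \<open>last js \<le> n\<close> \<open>hd js \<le> last js\<close> unfolding len j_def by (auto simp: back_dist_def)
        show "l \<le> back_dist n k j" if "k \<in> cols \<sigma>" for k
          using between[OF that] j * by (auto simp: back_dist_def split: if_splits)
      qed
      moreover have "j \<in> cols \<sigma> \<longleftrightarrow> l = length (interval n \<sigma> i)"
      proof
        assume "j \<in> cols \<sigma>"
        then have "j = hd js" using between[of j] j(2) by auto
        then show "l = length (interval n \<sigma> i)"
          using l \<open>last js \<le> n\<close> \<open>hd js \<le> last js\<close> unfolding len j_def by (auto split: if_splits)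
      next
        assume "l = length (interval n \<sigma> i)"
        then have "j = hd js" using \<open>hd js \<ge> 1\<close> unfolding len j_def by auto
        then show "j \<in> cols \<sigma>" using ends by simp
      qed
      ultimately show "\<exists>j\<in>{1..n}. interval n \<sigma> i ! (l - 1) = (1, j) \<and> gap n (cols \<sigma>) j = l \<and>
          (j \<in> cols \<sigma> \<longleftrightarrow> l = length (interval n \<sigma> i))"
        using j(1) nth by blast
    qed
  next
    case False
    define a b where "a = js ! (i - 2)" and "b = js ! (i - 1)"
    have i2: "i - 2 < length js" "i - 1 < length js" "i - 2 < i - 1" "i - 1 = Suc (i - 2)"
      using i False js(4) by (auto simp: card_first_row)
    have "sorted_wrt (<) js" using js(1,2) strict_sorted_iff by blast
    then have "a < b" unfolding a_def b_def using i2(3,2) by (rule sorted_wrt_nth_less)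
    moreover have "a \<in> cols \<sigma>" "b \<in> cols \<sigma>"
      unfolding a_def b_def js(3)[symmetric] by (rule nth_mem[OF i2(1)], rule nth_mem[OF i2(2)])
    ultimately have ab: "a < b" "a \<in> cols \<sigma>" "b \<in> cols \<sigma>" .
    have outside: "k \<le> a \<or> b \<le> k" if k: "k \<in> cols \<sigma>" for k
    proof -
      obtain p where p: "p < length js" "js ! p = k" using k unfolding js(3)[symmetric] in_set_conv_nth by blast
      show ?thesis
      proof (cases "p \<le> i - 2")
        case True
        then have "js ! p \<le> js ! (i - 2)" using js(1) i2(1) by (intro sorted_nth_mono)
        then show ?thesis using p(2) by (simp add: a_def)
      next
        case False
        then have "i - 1 \<le> p" using i2 by linarith
        then have "js ! (i - 1) \<le> js ! p" using p js(1) by (intro sorted_nth_mono) auto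
        then show ?thesis using p by (simp add: b_def)
      qed
    qed
    have int: "interval n \<sigma> i = map (Pair 1) [a + 1..<b + 1]"
      using False by (simp add: interval_def first_row_cols_eq js_def a_def b_def Let_def)
    have len: "length (interval n \<sigma> i) = b - a" by (simp add: int del: upt_Suc)
    show ?thesis
    proof (intro conjI impI)
      show "1 \<le> length (interval n \<sigma> i)" using len ab by simp
      assume l: "l \<in> {1..length (interval n \<sigma> i)}"
      have nth: "interval n \<sigma> i ! (l - 1) = (1, a + l)"
        using l unfolding len int by (auto simp del: upt_Suc)
      have j: "a + l \<in> {1..n}" "a + l \<le> b" using l between(3)[OF ab(3)] unfolding len by auto
      have "gap n (cols \<sigma>) (a + l) = l"
      proof (rule gap_eqI[OF fin ab(2)])
        show "back_dist n a (a + l) = l" using l by (simp add: back_dist_def)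
        show "l \<le> back_dist n k (a + l)" if "k \<in> cols \<sigma>" for k
          using outside[OF that] between(3)[OF that] j l by (auto simp: back_dist_def)
      qed
      moreover have "a + l \<in> cols \<sigma> \<longleftrightarrow> l = length (interval n \<sigma> i)"
      proof
        assume "a + l \<in> cols \<sigma>"
        then show "l = length (interval n \<sigma> i)" using outside[of "a + l"] l j(2) unfolding len by auto
      qed (use ab len in auto)
      ultimately show "\<exists>j\<in>{1..n}. interval n \<sigma> i ! (l - 1) = (1, j) \<and> gap n (cols \<sigma>) j = l \<and>
          (j \<in> cols \<sigma> \<longleftrightarrow> l = length (interval n \<sigma> i))"
        using j(1) nth by blast
    qed
  qed
  then show "length (interval n \<sigma> i) \<ge> 1"
    and "l \<in> {1..length (interval n \<sigma> i)} \<Longrightarrow>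
      \<exists>j\<in>{1..n}. interval n \<sigma> i ! (l - 1) = (1, j) \<and> gap n (cols \<sigma>) j = l \<and>
        (j \<in> cols \<sigma> \<longleftrightarrow> l = length (interval n \<sigma> i))"
    by blast+
qed

lemma intervals_cover:
  assumes J: "cols \<sigma> \<subseteq> {1..n}" "cols \<sigma> \<noteq> {}" and j: "j \<in> {1..n}"
  shows "\<exists>i\<in>{1..card (first_row \<sigma>)}. (1, j) \<in> set (interval n \<sigma> i)"
proof -
  define js where "js = sorted_list_of_set (cols \<sigma>)"
  have fin: "finite (cols \<sigma>)" using J(1) finite_subset by blast
  have js: "set js = cols \<sigma>" "length js = card (first_row \<sigma>)" "js \<noteq> []"
    using fin J(2) by (auto simp: js_def card_first_row)
  have len: "card (first_row \<sigma>) \<ge> 1" using js(2,3) by (cases js) auto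
  show ?thesis
  proof (cases "j \<le> hd js \<or> j > last js")
    case True
    then have "(1, j) \<in> set (interval n \<sigma> 1)"
      using j by (auto simp: interval_def first_row_cols_eq js_def Let_def simp del: upt_Suc)
    then show ?thesis using len by (intro bexI[of _ 1]) auto
  next
    case False
    let ?p = "LEAST p. p < length js \<and> j \<le> js ! p"
    have "length js - 1 < length js \<and> j \<le> js ! (length js - 1)"
      using False js(3) by (auto simp: last_conv_nth)
    then have p: "?p < length js \<and> j \<le> js ! ?p" by (rule LeastI)
    have "?p \<noteq> 0"
    proof
      assume "?p = 0"
      then have "j \<le> js ! 0" using p by metis
      then show False using False js(3) by (simp add: hd_conv_nth)
    qed
    then have "\<not> (?p - 1 < length js \<and> j \<le> js ! (?p - 1))" by (intro not_less_Least) simp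
    then have "js ! (?p - 1) < j" using p by auto
    then have "(1, j) \<in> set (interval n \<sigma> (?p + 1))"
      using \<open>?p \<noteq> 0\<close> p unfolding interval_def first_row_cols_eq js_def[symmetric] Let_def
      by (auto simp del: upt_Suc)
    moreover have "?p + 1 \<in> {1..card (first_row \<sigma>)}" using p js(2) by simp
    ultimately show ?thesis by blast
  qed
qed

lemma intervals_entry_of_col:
  assumes J: "cols \<sigma> \<subseteq> {1..n}" "cols \<sigma> \<noteq> {}" and j: "j \<in> {1..n}"
  obtains N where "N \<in> intervals n \<sigma>" "gap n (cols \<sigma>) j \<in> {1..length N}"
    "N ! (gap n (cols \<sigma>) j - 1) = (1, j)" "j \<in> cols \<sigma> \<longleftrightarrow> gap n (cols \<sigma>) j = length N"
proof -
  obtain i where i: "i \<in> {1..card (first_row \<sigma>)}" "(1, j) \<in> set (interval n \<sigma> i)"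
    using intervals_cover[OF assms] by blast
  let ?N = "interval n \<sigma> i"
  obtain p where p: "p < length ?N" "?N ! p = (1, j)" using i(2) by (metis in_set_conv_nth)
  then have "Suc p \<in> {1..length ?N}" by simp
  then obtain k where k: "?N ! (Suc p - 1) = (1, k)" "gap n (cols \<sigma>) k = Suc p"
      "k \<in> cols \<sigma> \<longleftrightarrow> Suc p = length ?N"
    using interval_entries(2)[OF J i(1)] by blast
  then have "k = j" using p(2) by simp
  then show thesis
    using that[of ?N] p k i(1) by (auto simp: intervals_def)
qed

section \<open>Cancellation by toggling active columns\<close>

text \<open>The condition on neighbours treats the elements of an independent set and its free vertices
  alike, which is what lets a column stay active when it is toggled.\<close>

definition active :: "nat \<Rightarrow> vertex set \<Rightarrow> nat set" where
  "active n \<sigma> = {j \<in> {1..n}. even (gap n (cols \<sigma>) j) \<and> (\<forall>y\<in>\<sigma>. \<not> adjacent n (1, j) y)}"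

lemma cols_subset: "\<sigma> \<in> independent_sets m n \<Longrightarrow> cols \<sigma> \<subseteq> {1..n}"
  by (auto simp: independent_sets_def vertices_def cols_def)

lemma cols_toggle: "cols (toggle (1, x) \<sigma>) = toggle x (cols \<sigma>)"
  by (auto simp: cols_def toggle_def)

text \<open>The gap increases by 1 from an unoccupied column to the next and is 1 after an occupied one,
  so neighbouring columns cannot both have even gaps. Therefore active vertices do not obstruct
  each other.\<close>

lemma not_adjacent_even_gap:
  assumes J: "J \<subseteq> {1..n}" "J \<noteq> {}" and n: "n \<ge> 3"
    and xj: "x \<in> {1..n}" "j \<in> {1..n}" "even (gap n J x)" "even (gap n J j)"
  shows "\<not> adjacent n (1, x) (1, j)"
proof -
  have "x \<noteq> next_col n j" "j \<noteq> next_col n x"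
    using not_both_even_gap[OF J xj(2,4)] not_both_even_gap[OF J xj(1,3)] xj(3,4) by metis+
  then show ?thesis using adjacent_iff[OF n xj(1,2)] by simp
qed

lemma toggle_active:
  assumes n: "odd n" "n \<ge> 3" and m: "m \<ge> 1" and \<sigma>: "\<sigma> \<in> independent_sets m n" "cols \<sigma> \<noteq> {}"
    and x: "x \<in> active n \<sigma>"
  shows "toggle (1, x) \<sigma> \<in> independent_sets m n"
    and "cols (toggle (1, x) \<sigma>) \<noteq> {}"
    and "active n (toggle (1, x) \<sigma>) = active n \<sigma>"
proof -
  note J = cols_subset[OF \<sigma>(1)] \<sigma>(2)
  have x1: "x \<in> {1..n}" "even (gap n (cols \<sigma>) x)" "\<And>y. y \<in> \<sigma> \<Longrightarrow> \<not> adjacent n (1, x) y"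
    using x by (auto simp: active_def)
  have x2: "\<not> adjacent n y (1, x)" if "y \<in> \<sigma>" for y
    using x1(3)[OF that] sympD[OF symp_adjacent] by blast
  have x0: "\<not> adjacent n (1, x) (1, x)"
    by (rule not_adjacent_even_gap[OF J n(2) x1(1,1,2,2)])
  show "toggle (1, x) \<sigma> \<in> independent_sets m n"
    using \<sigma>(1) x1 x2 x0 m by (auto simp: independent_sets_def toggle_def vertices_def)
  show "cols (toggle (1, x) \<sigma>) \<noteq> {}"
    unfolding cols_toggle by (rule toggle_even_gap(1)[OF n(1) J x1(1,2)])
  have "(\<forall>y\<in>toggle (1, x) \<sigma>. \<not> adjacent n (1, j) y) \<longleftrightarrow> (\<forall>y\<in>\<sigma>. \<not> adjacent n (1, j) y)"
    if "j \<in> {1..n}" "even (gap n (cols \<sigma>) j)" for j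
    using not_adjacent_even_gap[OF J n(2) that(1) x1(1) that(2) x1(2)] by (auto simp: toggle_def)
  then show "active n (toggle (1, x) \<sigma>) = active n \<sigma>"
    using toggle_even_gap(2)[OF n(1) J x1(1,2)] unfolding active_def cols_toggle by blast
qed

lemma sum_with_active_eq_0:
  assumes n: "odd n" "n \<ge> 3" and m: "m \<ge> 1"
  shows "(\<Sum>\<sigma> | \<sigma> \<in> independent_sets m n \<and> cols \<sigma> \<noteq> {} \<and> active n \<sigma> \<noteq> {}. (-1) ^ card \<sigma>) = (0 :: int)"
proof (rule sum_toggle_eq_0[where f = "\<lambda>\<sigma>. (1, Min (active n \<sigma>))"])
  fix \<sigma> assume "\<sigma> \<in> {\<sigma>. \<sigma> \<in> independent_sets m n \<and> cols \<sigma> \<noteq> {} \<and> active n \<sigma> \<noteq> {}}"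
  then have \<sigma>: "\<sigma> \<in> independent_sets m n" "cols \<sigma> \<noteq> {}" "active n \<sigma> \<noteq> {}" by auto
  have "finite (active n \<sigma>)" by (simp add: active_def)
  then have "Min (active n \<sigma>) \<in> active n \<sigma>" using \<sigma>(3) by simp
  note tog = toggle_active[OF n m \<sigma>(1,2) this]
  show "finite \<sigma>"
    using \<sigma>(1) finite_subset[of \<sigma> "{1..m} \<times> {1..n}"] by (simp add: independent_sets_def vertices_def)
  show "toggle (1, Min (active n \<sigma>)) \<sigma> \<in> {\<sigma>. \<sigma> \<in> independent_sets m n \<and> cols \<sigma> \<noteq> {} \<and> active n \<sigma> \<noteq> {}}"
    using tog \<sigma>(3) by simp
  show "(1, Min (active n (toggle (1, Min (active n \<sigma>)) \<sigma>))) = (1, Min (active n \<sigma>))"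
    unfolding tog(3) ..
qed

lemma free_in_iff:
  assumes n: "n \<ge> 3" and m: "m \<ge> 1" and \<sigma>: "\<sigma> \<in> independent_sets m n" and j: "j \<in> {1..n}"
  shows "free_in m n \<sigma> (1, j) \<longleftrightarrow> (1, j) \<notin> \<sigma> \<and> (\<forall>y\<in>\<sigma>. \<not> adjacent n (1, j) y)"
proof -
  have "\<not> adjacent n (1, j) (1, j)"
    using adjacent_iff[OF n j j] n by (auto simp: next_col_def)
  moreover have "adjacent n (1, j) y \<longleftrightarrow> adjacent n y (1, j)" for y
    using sympD[OF symp_adjacent] by blast
  moreover have "(1, j) \<in> vertices m n" using m j by (simp add: vertices_def)
  ultimately show ?thesis
    using \<sigma> unfolding free_in_def independent_sets_def by blast
qed

text \<open>For members of \<open>Q2 m n\<close>, having only odd intervals and having no free vertex in an even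
  position together say that there is no active column.\<close>

lemma Q2_iff:
  assumes n: "n \<ge> 3" and m: "m \<ge> 1"
  shows "\<sigma> \<in> Q2 m n \<longleftrightarrow> \<sigma> \<in> independent_sets m n \<and> cols \<sigma> \<noteq> {} \<and> active n \<sigma> = {} \<and>
    (\<exists>j\<in>cols \<sigma>. gap n (cols \<sigma>) j > 3)"
proof (cases "\<sigma> \<in> independent_sets m n \<and> cols \<sigma> \<noteq> {}")
  case False
  then show ?thesis by (auto simp: Q2_def first_row_eq_image)
next
  case True
  then have \<sigma>: "\<sigma> \<in> independent_sets m n" and J: "cols \<sigma> \<subseteq> {1..n}" "cols \<sigma> \<noteq> {}"
    using cols_subset by auto
  have last_entry: "\<exists>j\<in>cols \<sigma>. gap n (cols \<sigma>) j = length N" if N: "N \<in> intervals n \<sigma>" for N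
  proof -
    obtain i where i: "i \<in> {1..card (first_row \<sigma>)}" "N = interval n \<sigma> i"
      using N by (auto simp: intervals_def)
    then show ?thesis
      using interval_entries(1)[OF J i(1)] interval_entries(2)[OF J i(1), of "length N"] by auto
  qed
  have entry: "\<exists>j\<in>{1..n}. N ! (l - 1) = (1, j) \<and> gap n (cols \<sigma>) j = l"
    if N: "N \<in> intervals n \<sigma>" and l: "l \<in> {1..length N}" for N l
  proof -
    obtain i where i: "i \<in> {1..card (first_row \<sigma>)}" "N = interval n \<sigma> i"
      using N by (auto simp: intervals_def)
    then show ?thesis using interval_entries(2)[OF J i(1), of l] l by blast
  qed
  have in_cols: "\<forall>y\<in>\<sigma>. \<not> adjacent n (1, j) y" if "j \<in> cols \<sigma>" for j
    using \<sigma> that by (auto simp: independent_sets_def cols_def)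
  have odd_iff: "(\<forall>N\<in>intervals n \<sigma>. odd (length N)) \<longleftrightarrow> (\<forall>j\<in>cols \<sigma>. odd (gap n (cols \<sigma>) j))"
  proof
    assume odd: "\<forall>N\<in>intervals n \<sigma>. odd (length N)"
    show "\<forall>j\<in>cols \<sigma>. odd (gap n (cols \<sigma>) j)"
    proof
      fix j assume j: "j \<in> cols \<sigma>"
      then have "j \<in> {1..n}" using J(1) by blast
      then show "odd (gap n (cols \<sigma>) j)"
        using intervals_entry_of_col[OF J] odd j by metis
    qed
  next
    assume "\<forall>j\<in>cols \<sigma>. odd (gap n (cols \<sigma>) j)"
    then show "\<forall>N\<in>intervals n \<sigma>. odd (length N)" using last_entry by metis
  qed
  have long_iff: "(\<exists>N\<in>intervals n \<sigma>. length N > 3) \<longleftrightarrow> (\<exists>j\<in>cols \<sigma>. gap n (cols \<sigma>) j > 3)"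
  proof
    assume "\<exists>N\<in>intervals n \<sigma>. length N > 3"
    then show "\<exists>j\<in>cols \<sigma>. gap n (cols \<sigma>) j > 3" using last_entry by metis
  next
    assume "\<exists>j\<in>cols \<sigma>. gap n (cols \<sigma>) j > 3"
    then obtain j where j: "j \<in> cols \<sigma>" "gap n (cols \<sigma>) j > 3" by blast
    then have "j \<in> {1..n}" using J(1) by blast
    then show "\<exists>N\<in>intervals n \<sigma>. length N > 3"
      using intervals_entry_of_col[OF J] j by metis
  qed
  have free_iff: "(\<forall>N\<in>intervals n \<sigma>. \<forall>l\<in>{1..length N}. even l \<longrightarrow> \<not> free_in m n \<sigma> (N ! (l - 1))) \<longleftrightarrow>
      (\<forall>j\<in>{1..n}. even (gap n (cols \<sigma>) j) \<longrightarrow> \<not> free_in m n \<sigma> (1, j))"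
  proof
    assume nfree: "\<forall>N\<in>intervals n \<sigma>. \<forall>l\<in>{1..length N}. even l \<longrightarrow> \<not> free_in m n \<sigma> (N ! (l - 1))"
    show "\<forall>j\<in>{1..n}. even (gap n (cols \<sigma>) j) \<longrightarrow> \<not> free_in m n \<sigma> (1, j)"
    proof (intro ballI impI)
      fix j assume j: "j \<in> {1..n}" "even (gap n (cols \<sigma>) j)"
      obtain N where "N \<in> intervals n \<sigma>" "gap n (cols \<sigma>) j \<in> {1..length N}"
        "N ! (gap n (cols \<sigma>) j - 1) = (1, j)"
        by (rule intervals_entry_of_col[OF J j(1)])
      then show "\<not> free_in m n \<sigma> (1, j)" using nfree j(2) by metis
    qed
  next
    assume nfree: "\<forall>j\<in>{1..n}. even (gap n (cols \<sigma>) j) \<longrightarrow> \<not> free_in m n \<sigma> (1, j)"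
    then show "\<forall>N\<in>intervals n \<sigma>. \<forall>l\<in>{1..length N}. even l \<longrightarrow> \<not> free_in m n \<sigma> (N ! (l - 1))"
      using entry by metis
  qed
  have "active n \<sigma> = {} \<longleftrightarrow> (\<forall>j\<in>cols \<sigma>. odd (gap n (cols \<sigma>) j)) \<and>
      (\<forall>j\<in>{1..n}. even (gap n (cols \<sigma>) j) \<longrightarrow> \<not> free_in m n \<sigma> (1, j))"
    using in_cols J(1) free_in_iff[OF n m \<sigma>] unfolding active_def cols_def by blast
  then show ?thesis
    unfolding Q2_def mem_Collect_eq odd_iff long_iff free_iff using True
    by (auto simp: first_row_eq_image)
qed

text \<open>Without active columns all intervals are odd. If none is longer than 3, all have length 3, as
  length 1 would mean two adjacent first-row vertices.\<close>

lemma no_active_cases: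
  assumes n: "n \<ge> 3" and m: "m \<ge> 1"
  shows "{\<sigma> \<in> independent_sets m n. cols \<sigma> \<noteq> {} \<and> active n \<sigma> = {}} =
    Q2 m n \<union> {\<sigma> \<in> independent_sets m n. 3 dvd n \<and> (\<exists>c<3. cols \<sigma> = residue_cols n c)}" (is "?L = _ \<union> ?P")
    and "Q2 m n \<inter> {\<sigma> \<in> independent_sets m n. 3 dvd n \<and> (\<exists>c<3. cols \<sigma> = residue_cols n c)} = {}"
proof -
  show "Q2 m n \<inter> ?P = {}"
  proof -
    have False if Q: "\<sigma> \<in> Q2 m n" and d: "3 dvd n" and c: "c < 3" "cols \<sigma> = residue_cols n c" for \<sigma> c
    proof -
      obtain j where j: "j \<in> residue_cols n c" "gap n (residue_cols n c) j > 3"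
        using Q Q2_iff[OF n m] c(2) by metis
      then have "j \<in> {1..n}" by (simp add: residue_cols_def)
      then show False using gap_residue_cols(1)[OF d n c(1), of j] j(2) by simp
    qed
    then show ?thesis by blast
  qed
  have "\<sigma> \<in> ?L" if P: "\<sigma> \<in> ?P" for \<sigma>
  proof -
    obtain c where \<sigma>: "\<sigma> \<in> independent_sets m n" "3 dvd n" and c: "c < 3" "cols \<sigma> = residue_cols n c"
      using P by blast
    have "cols \<sigma> \<noteq> {}"
    proof -
      have "(if c = 0 then 3 else c) \<in> residue_cols n c" using c(1) n by (auto simp: residue_cols_def)
      then show ?thesis using c(2) by blast
    qed
    moreover have False if j: "j \<in> active n \<sigma>" for j
    proof -
      have j1: "j \<in> {1..n}" "even (gap n (residue_cols n c) j)" using j c(2) by (auto simp: active_def)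
      have "next_col n j \<in> cols \<sigma>" using gap_residue_cols(3)[OF \<sigma>(2) n c(1) j1] c(2) by simp
      moreover have "next_col n j \<in> {1..n}" using j1(1) by (auto simp: next_col_def)
      then have "adjacent n (1, j) (1, next_col n j)" using adjacent_iff[OF n j1(1)] by simp
      ultimately show False using j by (auto simp: active_def cols_def)
    qed
    ultimately show ?thesis using \<sigma>(1) by blast
  qed
  moreover have "\<sigma> \<in> Q2 m n \<union> ?P" if L: "\<sigma> \<in> ?L" for \<sigma>
  proof (cases "\<sigma> \<in> Q2 m n")
    case False
    have \<sigma>: "\<sigma> \<in> independent_sets m n" and J: "cols \<sigma> \<subseteq> {1..n}" "cols \<sigma> \<noteq> {}" and act: "active n \<sigma> = {}"
      using L cols_subset by auto
    have gap3: "gap n (cols \<sigma>) j = 3" if j: "j \<in> cols \<sigma>" for j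
    proof -
      have "\<not> gap n (cols \<sigma>) j > 3" using False \<sigma> J(2) act j Q2_iff[OF n m] by blast
      then have le: "gap n (cols \<sigma>) j \<le> 3" by simp
      have jn: "j \<in> {1..n}" using j J(1) by blast
      have indep: "\<not> adjacent n (1, i) (1, k)" if "i \<in> cols \<sigma>" "k \<in> cols \<sigma>" for i k
        using \<sigma> that by (auto simp: independent_sets_def cols_def)
      have odd: "odd (gap n (cols \<sigma>) j)"
        using act j jn \<sigma> by (auto simp: active_def independent_sets_def cols_def)
      have "gap n (cols \<sigma>) j \<noteq> 1"
      proof
        assume 1: "gap n (cols \<sigma>) j = 1"
        have "finite (cols \<sigma>)" using J(1) finite_subset by blast
        then obtain k where k: "k \<in> cols \<sigma>" "back_dist n k j = 1" using gap_attained[OF _ J(2)] 1 by metis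
        then have kn: "k \<in> {1..n}" using J(1) by blast
        then have "j = next_col n k" using k(2) jn by (auto simp: back_dist_def next_col_def split: if_splits)
        then show False using adjacent_iff[OF n jn kn] indep[OF j k(1)] by simp
      qed
      then show ?thesis using odd le gap_pos[OF J jn] by presburger
    qed
    show ?thesis using all_gaps_3[OF J n gap3] \<sigma> by blast
  qed simp
  moreover have "\<sigma> \<in> ?L" if "\<sigma> \<in> Q2 m n" for \<sigma>
    using that Q2_iff[OF n m] by blast
  ultimately show "?L = Q2 m n \<union> ?P" by blast
qed

section \<open>The recursion over the rows\<close>

text \<open>All vertices are loops, so only the empty set is independent.\<close>

lemma Z_circumference_1: "Z m 1 = 1"
proof -
  have "adjacent 1 x x" for x by (simp add: adjacent_def)
  then have "\<sigma> = {}" if "\<sigma> \<in> independent_sets m 1" for \<sigma>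
    using that unfolding independent_sets_def by blast
  moreover have "{} \<in> independent_sets m 1" by (simp add: independent_sets_def)
  ultimately have "independent_sets m 1 = {{}}" by blast
  then show ?thesis by (simp add: Z_def)
qed

lemma sum_empty_first_row:
  "(\<Sum>\<sigma> | \<sigma> \<in> independent_sets (Suc m) n \<and> cols \<sigma> = {}. (-1) ^ card \<sigma>) = Z m n"
proof -
  let ?f = "\<lambda>(i, j). (Suc i, j)"
  have "{\<sigma>. \<sigma> \<in> independent_sets (Suc m) n \<and> cols \<sigma> = {}} = indep (adjacent n) ({2..Suc m} \<times> {1..n})"
    (is "?L = ?R")
  proof
    show "?L \<subseteq> ?R"
    proof
      fix \<sigma> assume "\<sigma> \<in> ?L"
      then have \<sigma>: "\<sigma> \<in> indep (adjacent n) ({1..Suc m} \<times> {1..n})" "cols \<sigma> = {}"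
        by (auto simp: independent_sets_eq_indep)
      have "w \<in> {2..Suc m} \<times> {1..n}" if "w \<in> \<sigma>" for w
      proof -
        have "fst w \<noteq> 1" using \<sigma>(2) that by (cases w) (auto simp: cols_def)
        moreover have "w \<in> {1..Suc m} \<times> {1..n}" using \<sigma>(1) that by (auto simp: indep_def)
        ultimately show ?thesis by (cases w) auto
      qed
      then show "\<sigma> \<in> ?R" using \<sigma>(1) by (auto simp: indep_def)
    qed
    show "?R \<subseteq> ?L"
    proof
      fix \<sigma> assume \<sigma>: "\<sigma> \<in> ?R"
      have "{2..Suc m} \<times> {1..n} \<subseteq> {1..Suc m} \<times> {1..n}" by auto
      then have "\<sigma> \<in> independent_sets (Suc m) n"
        using \<sigma> unfolding independent_sets_eq_indep indep_def by blast
      moreover have "(1, j) \<notin> \<sigma>" for j using \<sigma> by (auto simp: indep_def)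
      ultimately show "\<sigma> \<in> ?L" by (simp add: cols_def)
    qed
  qed
  then have "(\<Sum>\<sigma> | \<sigma> \<in> independent_sets (Suc m) n \<and> cols \<sigma> = {}. (-1) ^ card \<sigma>) =
      indep_sum (adjacent n) ({2..Suc m} \<times> {1..n})"
    by (simp add: indep_sum_def)
  also have "{2..Suc m} \<times> {1..n} = ?f ` ({1..m} \<times> {1..n})"
  proof -
    have "w \<in> ?f ` ({1..m} \<times> {1..n})" if w: "w \<in> {2..Suc m} \<times> {1..n}" for w
    proof (rule image_eqI)
      show "w = ?f (fst w - 1, snd w)" "(fst w - 1, snd w) \<in> {1..m} \<times> {1..n}"
        using w by auto
    qed
    then show ?thesis by auto
  qed
  also have "indep_sum (adjacent n) \<dots> = indep_sum (adjacent n) ({1..m} \<times> {1..n})"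
    by (rule indep_sum_image) (auto simp: inj_on_def adjacent_def)
  finally show ?thesis by (simp add: Z_eq_indep_sum)
qed

lemma sum_Q2_eq_0:
  assumes "\<And>\<sigma>. \<sigma> \<in> Q2 m n \<Longrightarrow>
    (\<Sum>\<tau> | \<tau> \<in> Q2 m n \<and> first_row \<tau> = first_row \<sigma>. (-1) ^ card \<tau>) = (0 :: int)"
  shows "(\<Sum>\<sigma>\<in>Q2 m n. (-1) ^ card \<sigma>) = (0 :: int)"
proof -
  have fin: "finite (Q2 m n)"
    using finite_independent_sets by (rule rev_finite_subset) (auto simp: Q2_def)
  have "(\<Sum>\<sigma>\<in>Q2 m n. (-1) ^ card \<sigma>) =
      (\<Sum>\<rho>\<in>first_row ` Q2 m n. \<Sum>\<tau> | \<tau> \<in> Q2 m n \<and> first_row \<tau> = \<rho>. (-1) ^ card \<tau> :: int)"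
    by (rule sum.image_gen[OF fin])
  also have "\<dots> = 0"
    by (rule sum.neutral) (auto simp: assms)
  finally show ?thesis .
qed

lemma next_col_mod_3:
  "3 dvd n \<Longrightarrow> next_col n j mod 3 = (j + 1) mod 3"
  by (auto simp: next_col_def elim!: dvdE)

lemma residue_cols_independent:
  assumes n: "3 dvd n" "n \<ge> 3" and jk: "j \<in> residue_cols n c" "k \<in> residue_cols n c"
  shows "\<not> adjacent n (r, j) (r, k)"
proof -
  have mod_Suc: "(x + 1) mod 3 \<noteq> x mod 3" for x :: nat by presburger
  have "j \<noteq> next_col n k" "k \<noteq> next_col n j"
    using jk next_col_mod_3[OF n(1)] mod_Suc unfolding residue_cols_def mem_Collect_eq by metis+
  then show ?thesis
    using adjacent_iff[OF n(2), of j k] jk by (simp add: residue_cols_def)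
qed

text \<open>A residue class is a maximal independent set of the row. Hence prescribing it as the first row
  is the same as requiring it to be contained in the independent set.\<close>

lemma residue_cols_dominating:
  assumes n: "3 dvd n" "n \<ge> 3" and c: "c < 3" and j: "j \<in> {1..n}" "j \<notin> residue_cols n c"
  shows "\<exists>k\<in>residue_cols n c. adjacent n (r, k) (r, j)"
proof -
  define i where "i = (if j = 1 then n else j - 1)"
  have i: "i \<in> {1..n}" "next_col n i = j" using j(1) n(2) by (auto simp: i_def next_col_def)
  have nxt: "next_col n j \<in> {1..n}" using j(1) by (auto simp: next_col_def)
  have "j mod 3 \<noteq> c" using j by (simp add: residue_cols_def)
  moreover have "j mod 3 = (i + 1) mod 3" using next_col_mod_3[OF n(1), of i] i(2) by simp
  moreover have "(j + 1) mod 3 = (j mod 3 + 1) mod 3" "(i + 1) mod 3 = (i mod 3 + 1) mod 3"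
    by (simp_all only: mod_add_left_eq)
  moreover have "i mod 3 = 0 \<or> i mod 3 = 1 \<or> i mod 3 = 2" "c = 0 \<or> c = 1 \<or> c = 2"
    using c by linarith+
  ultimately have "i mod 3 = c \<or> (j + 1) mod 3 = c" by auto
  then have "i \<in> residue_cols n c \<or> next_col n j \<in> residue_cols n c"
    using i nxt next_col_mod_3[OF n(1), of j] by (auto simp: residue_cols_def)
  moreover have "adjacent n (r, i) (r, j)" using adjacent_iff[OF n(2) i(1) j(1)] i(2) by simp
  moreover have "adjacent n (r, next_col n j) (r, j)" using adjacent_iff[OF n(2) nxt j(1)] by simp
  ultimately show ?thesis by blast
qed

lemma odd_card_residue_cols:
  assumes n: "odd n" "3 dvd n" and c: "c < 3"
  shows "odd (card (residue_cols n c))"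
proof -
  obtain t where t: "n = 3 * t" using n by auto
  let ?s = "if c = 0 then 3 else c"
  have "residue_cols n c = (\<lambda>i. 3 * i + ?s) ` {..<t}"
  proof
    show "(\<lambda>i. 3 * i + ?s) ` {..<t} \<subseteq> residue_cols n c"
      using t c by (auto simp: residue_cols_def)
    show "residue_cols n c \<subseteq> (\<lambda>i. 3 * i + ?s) ` {..<t}"
    proof
      fix j assume "j \<in> residue_cols n c"
      then have j: "1 \<le> j" "j \<le> 3 * t" "j mod 3 = c" by (auto simp: residue_cols_def t)
      have dec: "j = 3 * (j div 3) + c" using j(3) mult_div_mod_eq[of 3 j] by simp
      show "j \<in> (\<lambda>i. 3 * i + ?s) ` {..<t}"
      proof (cases "c = 0")
        case True
        then have "j = 3 * (j div 3 - 1) + 3 \<and> j div 3 - 1 < t" using dec j(1,2) by linarith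
        then show ?thesis using True by auto
      next
        case False
        then have "j div 3 < t" using dec j(2) by linarith
        then show ?thesis using False dec by auto
      qed
    qed
  qed
  moreover have "inj_on (\<lambda>i. 3 * i + ?s) {..<t}" by (auto simp: inj_on_def)
  ultimately have "card (residue_cols n c) = t" by (simp add: card_image)
  then show ?thesis using n t by simp
qed

definition grid_top_not_residue :: "nat \<Rightarrow> nat \<Rightarrow> nat \<Rightarrow> vertex set" where
  "grid_top_not_residue n m c = {(i, j). i \<in> {2..m} \<and> j \<in> {1..n} \<and> (i = 2 \<longrightarrow> j mod 3 \<noteq> c)}"

text \<open>Rotating the cylinder by one column reduces all residue classes to the multiples of 3.\<close>

lemma indep_sum_grid_top_not_residue_rotate:
  assumes n: "3 dvd n" "n \<ge> 3" and c: "c < 3"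
  shows "indep_sum (adjacent n) (grid_top_not_residue n m ((c + 1) mod 3)) = indep_sum (adjacent n) (grid_top_not_residue n m c)"
proof -
  let ?f = "\<lambda>(i, j). (i, next_col n j)"
  have inj: "j = k" if "next_col n j = next_col n k" "j \<in> {1..n}" "k \<in> {1..n}" for j k
    using that by (cases "j = n"; cases "k = n") (simp_all add: next_col_def)
  have step: "(j + 1) mod 3 = (c + 1) mod 3 \<longleftrightarrow> j mod 3 = c" for j :: nat
    using cong_add_rcancel_nat[of j 1 c 3] c unfolding cong_def by (simp only: mod_less)
  have range: "next_col n j \<in> {1..n}" if "j \<in> {1..n}" for j
    using that by (auto simp: next_col_def)
  have "?f ` grid_top_not_residue n m c = grid_top_not_residue n m ((c + 1) mod 3)"
  proof
    show "?f ` grid_top_not_residue n m c \<subseteq> grid_top_not_residue n m ((c + 1) mod 3)"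
    proof
      fix w assume "w \<in> ?f ` grid_top_not_residue n m c"
      then obtain i j where ij: "(i, j) \<in> grid_top_not_residue n m c" "w = (i, next_col n j)" by auto
      then show "w \<in> grid_top_not_residue n m ((c + 1) mod 3)"
        using range[of j] step[of j] next_col_mod_3[OF n(1), of j] unfolding grid_top_not_residue_def by force
    qed
    show "grid_top_not_residue n m ((c + 1) mod 3) \<subseteq> ?f ` grid_top_not_residue n m c"
    proof
      fix w assume w: "w \<in> grid_top_not_residue n m ((c + 1) mod 3)"
      obtain i k where ik: "w = (i, k)" by fastforce
      then have k: "i \<in> {2..m}" "k \<in> {1..n}" "i = 2 \<Longrightarrow> k mod 3 \<noteq> (c + 1) mod 3"
        using w by (auto simp: grid_top_not_residue_def)
      define j where "j = (if k = 1 then n else k - 1)"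
      have j: "j \<in> {1..n}" "next_col n j = k" using k(2) n(2) by (auto simp: j_def next_col_def)
      then have "(i, j) \<in> grid_top_not_residue n m c"
        using k step[of j] next_col_mod_3[OF n(1), of j] unfolding grid_top_not_residue_def by force
      moreover have "w = ?f (i, j)" using ik j(2) by simp
      ultimately show "w \<in> ?f ` grid_top_not_residue n m c" by blast
    qed
  qed
  moreover have "indep_sum (adjacent n) (?f ` grid_top_not_residue n m c) = indep_sum (adjacent n) (grid_top_not_residue n m c)"
  proof (rule indep_sum_image)
    show "inj_on ?f (grid_top_not_residue n m c)" using inj by (auto simp: inj_on_def grid_top_not_residue_def)
    fix x y assume xy: "x \<in> grid_top_not_residue n m c" "y \<in> grid_top_not_residue n m c"
    obtain i j k l where eq: "x = (i, j)" "y = (k, l)" by fastforce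
    have jl: "j \<in> {1..n}" "l \<in> {1..n}" using xy eq by (auto simp: grid_top_not_residue_def)
    note njl = range[OF jl(1)] range[OF jl(2)]
    have "next_col n j = next_col n (next_col n l) \<longleftrightarrow> j = next_col n l"
      "next_col n l = next_col n (next_col n j) \<longleftrightarrow> l = next_col n j"
      "next_col n j = next_col n l \<longleftrightarrow> j = l"
      using inj jl njl by metis+
    then show "adjacent n (?f x) (?f y) \<longleftrightarrow> adjacent n x y"
      unfolding eq prod.case adjacent_iff[OF n(2) jl] adjacent_iff[OF n(2) njl] by simp
  qed
  ultimately show ?thesis by simp
qed

lemma indep_sum_grid_top_not_residue:
  assumes n: "3 dvd n" "n \<ge> 3" and c: "c < 3"
  shows "indep_sum (adjacent n) (grid_top_not_residue n m c) = indep_sum (adjacent n) (grid_top_not3 n 2 m)"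
proof -
  have "grid_top_not_residue n m 0 = grid_top_not3 n 2 m" by (auto simp: grid_top_not_residue_def grid_top_not3_def dvd_eq_mod_eq_0)
  moreover have "indep_sum (adjacent n) (grid_top_not_residue n m 1) = indep_sum (adjacent n) (grid_top_not_residue n m 0)"
    using indep_sum_grid_top_not_residue_rotate[OF n, of 0 m] by simp
  moreover have "indep_sum (adjacent n) (grid_top_not_residue n m 2) = indep_sum (adjacent n) (grid_top_not_residue n m 1)"
    using indep_sum_grid_top_not_residue_rotate[OF n, of 1 m] by (simp add: numeral_2_eq_2)
  moreover have "c = 0 \<or> c = 1 \<or> c = 2" using c by linarith
  ultimately show ?thesis by metis
qed

lemma sum_first_row_residue_cols:
  assumes n: "odd n" "3 dvd n" "n \<ge> 3" and m: "m \<ge> 1" and c: "c < 3"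
  shows "(\<Sum>\<sigma> | \<sigma> \<in> independent_sets m n \<and> cols \<sigma> = residue_cols n c. (-1) ^ card \<sigma>) =
    - indep_sum (adjacent n) (grid_top_not3 n 2 m)"
proof -
  let ?A = "{1..m} \<times> {1..n}" and ?\<rho> = "Pair 1 ` residue_cols n c"
  have "residue_cols n c \<subseteq> {1..n}" by (auto simp: residue_cols_def)
  then have \<rho>: "?\<rho> \<in> indep (adjacent n) ?A"
    using residue_cols_independent[OF n(2,3), of _ c _ 1] m by (auto simp: indep_def)
  have "cols \<sigma> = residue_cols n c \<longleftrightarrow> ?\<rho> \<subseteq> \<sigma>" if \<sigma>: "\<sigma> \<in> independent_sets m n" for \<sigma>
  proof
    assume "?\<rho> \<subseteq> \<sigma>"
    then have sub: "residue_cols n c \<subseteq> cols \<sigma>" by (auto simp: cols_def)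
    have indep: "\<not> adjacent n (1, i) (1, k)" if "i \<in> cols \<sigma>" "k \<in> cols \<sigma>" for i k
      using \<sigma> that by (auto simp: independent_sets_def cols_def)
    have "cols \<sigma> \<subseteq> residue_cols n c"
      using residue_cols_dominating[OF n(2,3) c, of _ 1] indep sub cols_subset[OF \<sigma>] by blast
    then show "cols \<sigma> = residue_cols n c" using sub by blast
  qed (auto simp: cols_def)
  then have fam: "{\<sigma>. \<sigma> \<in> independent_sets m n \<and> cols \<sigma> = residue_cols n c} =
      {\<sigma>. \<sigma> \<in> indep (adjacent n) ?A \<and> ?\<rho> \<subseteq> \<sigma>}"
    unfolding independent_sets_eq_indep by blast
  have rest: "{w \<in> ?A - ?\<rho>. \<forall>x\<in>?\<rho>. \<not> adjacent n x w} = grid_top_not_residue n m c" (is "?L = _")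
  proof
    show "?L \<subseteq> grid_top_not_residue n m c"
    proof
      fix w assume w: "w \<in> ?L"
      obtain i j where ij: "w = (i, j)" by fastforce
      have j: "i \<in> {1..m}" "j \<in> {1..n}" "i = 1 \<Longrightarrow> j \<notin> residue_cols n c"
        and nadj: "\<And>k. k \<in> residue_cols n c \<Longrightarrow> \<not> adjacent n (1, k) (i, j)"
        using w ij by auto
      have "i \<noteq> 1"
        using residue_cols_dominating[OF n(2,3) c j(2), of 1] j(3) nadj by blast
      moreover have "i = 2 \<Longrightarrow> j mod 3 \<noteq> c"
        using nadj[of j] j(2) adjacent_iff[OF n(3) j(2) j(2), of 1 2] by (auto simp: residue_cols_def)
      ultimately show "w \<in> grid_top_not_residue n m c" using j ij by (auto simp: grid_top_not_residue_def)
    qed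
    show "grid_top_not_residue n m c \<subseteq> ?L"
    proof
      fix w assume w: "w \<in> grid_top_not_residue n m c"
      obtain i j where ij: "w = (i, j)" by fastforce
      have j: "i \<in> {2..m}" "j \<in> {1..n}" "i = 2 \<Longrightarrow> j mod 3 \<noteq> c" using w ij by (auto simp: grid_top_not_residue_def)
      have "\<not> adjacent n (1, k) (i, j)" if k: "k \<in> residue_cols n c" for k
      proof -
        have kn: "k \<in> {1..n}" "k mod 3 = c" using k by (auto simp: residue_cols_def)
        show ?thesis using adjacent_iff[OF n(3) kn(1) j(2), of 1 i] j kn(2) by auto
      qed
      then show "w \<in> ?L" using j ij by auto
    qed
  qed
  have sign: "(-1) ^ card ?\<rho> = (-1 :: int)"
    using odd_card_residue_cols[OF n(1,2) c] by (simp add: card_image inj_on_def)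
  have "finite ?A" by simp
  note sum_indep_containing[OF this symp_adjacent \<rho>]
  then show ?thesis
    unfolding fam rest sign indep_sum_grid_top_not_residue[OF n(2,3) c] by simp
qed

lemma Z_Suc:
  assumes n: "odd n" "n \<ge> 3"
    and Q2: "\<And>\<sigma>. \<sigma> \<in> Q2 (Suc m) n \<Longrightarrow>
      (\<Sum>\<tau> | \<tau> \<in> Q2 (Suc m) n \<and> first_row \<tau> = first_row \<sigma>. (-1) ^ card \<tau>) = (0 :: int)"
  shows "Z (Suc m) n = Z m n - (if 3 dvd n then 3 * indep_sum (adjacent n) (grid_top_not3 n 2 (Suc m)) else 0)"
proof -
  let ?I = "independent_sets (Suc m) n"
  let ?s = "\<lambda>\<sigma>. (-1) ^ card \<sigma> :: int"
  let ?C = "\<lambda>c. {\<sigma> \<in> ?I. cols \<sigma> = residue_cols n c}"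
  let ?P = "{\<sigma> \<in> ?I. 3 dvd n \<and> (\<exists>c<3. cols \<sigma> = residue_cols n c)}"
  have fin: "finite {\<sigma> \<in> ?I. R \<sigma>}" for R using finite_independent_sets by simp
  have finQ: "finite (Q2 (Suc m) n)"
    using finite_independent_sets by (rule rev_finite_subset) (auto simp: Q2_def)
  have m: "Suc m \<ge> 1" by simp
  have split: "sum ?s {\<sigma> \<in> ?I. R \<sigma>} = sum ?s {\<sigma> \<in> ?I. R \<sigma> \<and> R' \<sigma>} + sum ?s {\<sigma> \<in> ?I. R \<sigma> \<and> \<not> R' \<sigma>}" for R R'
    by (subst sum.union_disjoint[symmetric]) (auto simp: fin intro!: sum.cong)
  have "Z (Suc m) n = sum ?s {\<sigma> \<in> ?I. True \<and> cols \<sigma> = {}} + sum ?s {\<sigma> \<in> ?I. True \<and> cols \<sigma> \<noteq> {}}"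
    using split[of "\<lambda>_. True"] by (simp add: Z_def)
  also have "sum ?s {\<sigma> \<in> ?I. True \<and> cols \<sigma> = {}} = Z m n"
    using sum_empty_first_row[of m n] by simp
  also have "sum ?s {\<sigma> \<in> ?I. True \<and> cols \<sigma> \<noteq> {}} =
      sum ?s {\<sigma> \<in> ?I. cols \<sigma> \<noteq> {} \<and> active n \<sigma> = {}} + sum ?s {\<sigma> \<in> ?I. cols \<sigma> \<noteq> {} \<and> active n \<sigma> \<noteq> {}}"
    using split[of "\<lambda>\<sigma>. cols \<sigma> \<noteq> {}" "\<lambda>\<sigma>. active n \<sigma> = {}"] by simp
  also have "sum ?s {\<sigma> \<in> ?I. cols \<sigma> \<noteq> {} \<and> active n \<sigma> \<noteq> {}} = 0"
    by (rule sum_with_active_eq_0[OF n m])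
  also have "sum ?s {\<sigma> \<in> ?I. cols \<sigma> \<noteq> {} \<and> active n \<sigma> = {}} = sum ?s (Q2 (Suc m) n) + sum ?s ?P"
    unfolding no_active_cases(1)[OF n(2) m]
    by (rule sum.union_disjoint[OF finQ fin no_active_cases(2)[OF n(2) m]])
  also have "sum ?s (Q2 (Suc m) n) = 0" by (rule sum_Q2_eq_0[OF Q2])
  also have "sum ?s ?P = - (if 3 dvd n then 3 * indep_sum (adjacent n) (grid_top_not3 n 2 (Suc m)) else 0)"
  proof (cases "3 dvd n")
    case True
    have ne: "residue_cols n c \<noteq> residue_cols n d" if cd: "c < 3" "d < 3" "c \<noteq> d" for c d
    proof -
      have "(if c = 0 then 3 else c) \<in> residue_cols n c" "(if c = 0 then 3 else c) \<notin> residue_cols n d"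
        using cd n(2) by (auto simp: residue_cols_def)
      then show ?thesis by metis
    qed
    have "?P = (\<Union>c\<in>{..<3}. ?C c)" using True by auto
    then have "sum ?s ?P = (\<Sum>c<3. sum ?s (?C c))"
      using fin ne by (simp only:) (rule sum.UNION_disjoint; auto)
    also have "\<dots> = (\<Sum>c<(3::nat). - indep_sum (adjacent n) (grid_top_not3 n 2 (Suc m)))"
      by (rule sum.cong) (use sum_first_row_residue_cols[OF n(1) True n(2) m] in auto)
    finally show ?thesis using True by simp
  qed simp
  finally show ?thesis by simp
qed

theorem proposition4p9:
  assumes "\<And>n m \<sigma>. odd n \<Longrightarrow> n \<ge> 1 \<Longrightarrow> m \<ge> 1 \<Longrightarrow> \<sigma> \<in> Q2 m n \<Longrightarrow>
    (\<Sum>\<tau> | \<tau> \<in> Q2 m n \<and> first_row \<tau> = first_row \<sigma>. (-1) ^ card \<tau>) = (0 :: int)"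
  shows "\<forall>n m. odd n \<longrightarrow> n \<ge> 1 \<longrightarrow> m \<ge> 1 \<longrightarrow>
    Z m n = (if 3 dvd gcd (m - 1) n then -2 else 1)"
proof (intro allI impI)
  fix n m :: nat
  assume n: "odd n" "n \<ge> 1" and m: "m \<ge> 1"
  show "Z m n = (if 3 dvd gcd (m - 1) n then -2 else 1)"
  proof (cases "n = 1")
    case True
    then show ?thesis using Z_circumference_1[of m] by simp
  next
    case False
    then have n3: "n \<ge> 3" using n by (cases "n = 2") auto
    have "Z k n = (if 3 dvd n \<and> k mod 3 = 1 then -2 else 1)" for k
    proof (induction k)
      case 0
      then show ?case by (simp add: Z_eq_indep_sum)
    next
      case (Suc k)
      have "Z (Suc k) n = Z k n - (if 3 dvd n then 3 * indep_sum (adjacent n) (grid_top_not3 n 2 (Suc k)) else 0)"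
        using n assms[of n "Suc k"] by (intro Z_Suc[OF n(1) n3]) auto
      moreover have "indep_sum (adjacent n) (grid_top_not3 n 2 (Suc k)) =
          (if k mod 3 = 0 then 1 else if k mod 3 = 1 then -1 else 0)" if "3 dvd n"
        using indep_sum_grid_top_not3_closed[OF n(1) that, of 2 "Suc k"] by simp
      moreover have "k mod 3 = 0 \<or> k mod 3 = 1 \<or> k mod 3 = 2" by linarith
      ultimately show ?case using Suc.IH by (auto simp: mod_Suc)
    qed
    moreover have "m mod 3 = 1 \<longleftrightarrow> 3 dvd m - 1" using m by presburger
    ultimately show ?thesis by auto
  qed
qed

end
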